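(* There exist a sequence $Q^{(N)}$, $N=1,2,\ldots$, of finite, rooted, binary tree-structured partitions of $\mathcal{U}^2=(0,1)^2$ into basic boxes of positive Lebesgue measure with $\|Q^{(N)}\|\to0$, and independent, identically distributed random vectors $(\mathbf{X},Y),(\mathbf{X}_1,Y_1),(\mathbf{X}_2,Y_2),\ldots$ with $\mathbf{X}$ uniformly distributed on $\mathcal{U}^2$, $Y\ge 0$ and $E(Y)<\infty$, such that, writing $m(\mathbf{x})=E(Y\mid\mathbf{X}=\mathbf{x})$, $$P\big(\hat m_N(\mathbf{X})-m_N(\mathbf{X})\to0\big)=1,\qquad P\big(m_N(\mathbf{X})-m(\mathbf{X})\to0\big)=0,\qquad P\big(\hat m_N(\mathbf{X})\to m(\mathbf{X})\big)=0,$$ and such that, in addition, the set $$\Big\{h\ge 0:\ E(h(\mathbf{X}))<\infty\ \text{ and }\ \limsup_{N\to\infty}h_N(\mathbf{x})<\infty\ \text{ for some }\mathbf{x}\in\mathcal{U}^2\Big\}$$ is of the first category in $\mathcal{L}^1(\mathcal{U}^2)$.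
   Context: Basic boxes. A basic box in $\mathcal{U}^2=(0,1)^2$ is a nonempty subset of $\mathcal{U}^2$ that is the solution set in $\mathcal{U}^2$ of a finite system of inequalities of the form $\mathbf{b}\cdot\mathbf{x}\le c$ or $\mathbf{b}\cdot\mathbf{x}>c$, where in each inequality $c$ is real and exactly one coordinate of $\mathbf{b}\in\mathbb{R}^2$ is nonzero. Thus it is a rectangle with sides parallel to the axes, each side being open or closed. Finite rooted binary tree. This is a finite nonempty set $T$ of positive integers with functions $\mathrm{left},\mathrm{right}:T\to T\cup\{0\}$ such that (1) for each $t\in T$ either $\mathrm{left}(t)=\mathrm{right}(t)=0$ ($t$ is then called terminal), or $\mathrm{left}(t)>t$ and $\mathrm{right}(t)>t$; (2) for each $t\in T$ other than the smallest element (the root) there is exactly one $s\in T$ with $t=\mathrm{left}(s)$ or $t=\mathrm{right}(s)$. Tree-structured partition. A finite partition of $\mathcal{U}^2$ into basic boxes is a finite, rooted, binary tree-structured partition if there is a finite rooted binary tree whose terminal nodes correspond bijectively to the members of the partition, compatibly with nesting: each node $t$ is associated with a basic box, the root with $\mathcal{U}^2$, the box of each nonterminal node is the disjoint union of the boxes of its left and right children, and the boxes of the terminal nodes are exactly the members of the partition. For $\mathbf{x}\in\mathcal{U}^2$, $B^{(N)}(\mathbf{x})$ is the unique member of $Q^{(N)}$ containing $\mathbf{x}$. The norm is $\|Q^{(N)}\|=\max_{\mathbf{x}}\sup\{\|\mathbf{z}-\mathbf{y}\|:\mathbf{y},\mathbf{z}\in B^{(N)}(\mathbf{x})\}$ (Euclidean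 distance). For $h\in\mathcal{L}^1(\mathcal{U}^2)$ (Lebesgue measure $\lambda$; $\mathbf{X}$ is uniform), regarded as a regression function, $$h_N(\mathbf{x})=\frac{1}{\lambda(B^{(N)}(\mathbf{x}))}\int_{B^{(N)}(\mathbf{x})}h(\mathbf{u})\,\lambda(d\mathbf{u}).$$ The function $m_N$ is defined from $m$ in the same way; equivalently $m_N(\mathbf{x})=E(Y I_{B^{(N)}(\mathbf{x})}(\mathbf{X}))/P(\mathbf{X}\in B^{(N)}(\mathbf{x}))$. Empirical estimate: with $B=B^{(N)}(\mathbf{x})$, $\hat\mu_N(B)=\frac1N\sum_{n=1}^N Y_nI_B(\mathbf{X}_n)$ and $\hat F_N(B)=\frac1N\sum_{n=1}^N I_B(\mathbf{X}_n)$, set $\hat m_N(\mathbf{x})=\hat\mu_N(B)/\hat F_N(B)$ if $\hat F_N(B)>0$ and $\hat m_N(\mathbf{x})=0$ otherwise. A subset of a metric space is of the first category if it is a countable union of nowhere dense sets; $\mathcal{L}^1(\mathcal{U}^2)$ carries the $\mathcal{L}^1$ norm (functions identified when equal almost everywhere). *)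

theory Defs
  imports "HOL-Probability.Probability"
begin

section \<open>Boxes, trees and partitions of the unit square\<close>

definition unit_square :: "(real ^ 2) set" where
  "unit_square = {x. \<forall>i. 0 < x $ i \<and> x $ i < 1}"

text \<open>
  A finite system of inequalities is a finite set \<open>L\<close> of pairs \<open>(b, c)\<close> for the constraints
  \<open>b \<bullet> x \<le> c\<close> together with a finite set \<open>G\<close> of pairs for the constraints \<open>b \<bullet> x > c\<close>.
\<close>
definition basic_box :: "(real ^ 2) set \<Rightarrow> bool" where
  "basic_box S \<longleftrightarrow> S \<noteq> {} \<and>
     (\<exists>L G :: ((real ^ 2) \<times> real) set.
        finite L \<and> finite G \<and>
        (\<forall>(b, c) \<in> L \<union> G. \<exists>!i. b $ i \<noteq> 0) \<and>
        S = {x \<in> unit_square. (\<forall>(b, c) \<in> L. b \<bullet> x \<le> c) \<and> (\<forall>(b, c) \<in> G. b \<bullet> x > c)})"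

definition finite_rooted_binary_tree :: "nat set \<Rightarrow> (nat \<Rightarrow> nat) \<Rightarrow> (nat \<Rightarrow> nat) \<Rightarrow> bool" where
  "finite_rooted_binary_tree T left right \<longleftrightarrow>
     finite T \<and> T \<noteq> {} \<and> (\<forall>t\<in>T. t > 0) \<and>
     (\<forall>t\<in>T. left t \<in> T \<union> {0} \<and> right t \<in> T \<union> {0}) \<and>
     (\<forall>t\<in>T. (left t = 0 \<and> right t = 0) \<or> (left t > t \<and> right t > t)) \<and>
     (\<forall>t\<in>T. t \<noteq> Min T \<longrightarrow> (\<exists>!s. s \<in> T \<and> (t = left s \<or> t = right s)))"

definition terminal_nodes :: "nat set \<Rightarrow> (nat \<Rightarrow> nat) \<Rightarrow> (nat \<Rightarrow> nat) \<Rightarrow> nat set" where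
  "terminal_nodes T left right = {t \<in> T. left t = 0 \<and> right t = 0}"

definition finite_box_partition :: "(real ^ 2) set set \<Rightarrow> bool" where
  "finite_box_partition Q \<longleftrightarrow>
     finite Q \<and> partition_on unit_square Q \<and> (\<forall>B\<in>Q. basic_box B)"

definition tree_structured_partition :: "(real ^ 2) set set \<Rightarrow> bool" where
  "tree_structured_partition Q \<longleftrightarrow> finite_box_partition Q \<and>
     (\<exists>T left right (node_box :: nat \<Rightarrow> (real ^ 2) set).
        finite_rooted_binary_tree T left right \<and>
        (\<forall>t\<in>T. basic_box (node_box t)) \<and>
        node_box (Min T) = unit_square \<and>
        (\<forall>t \<in> T - terminal_nodes T left right.
           node_box t = node_box (left t) \<union> node_box (right t) \<and>
           node_box (left t) \<inter> node_box (right t) = {}) \<and>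
        bij_betw node_box (terminal_nodes T left right) Q)"

definition cell :: "(real ^ 2) set set \<Rightarrow> real ^ 2 \<Rightarrow> (real ^ 2) set" where
  "cell Q x = (THE B. B \<in> Q \<and> x \<in> B)"

definition partition_norm :: "(real ^ 2) set set \<Rightarrow> real" where
  "partition_norm Q = Max ((\<lambda>x. diameter (cell Q x)) ` unit_square)"

section \<open>Cell averages and their empirical estimates\<close>

definition cell_average :: "(real ^ 2) set set \<Rightarrow> (real ^ 2 \<Rightarrow> real) \<Rightarrow> real ^ 2 \<Rightarrow> real" where
  "cell_average Q h x =
     (1 / measure lborel (cell Q x)) * (LINT u:cell Q x|lborel. h u)"

definition mu_hat :: "(nat \<Rightarrow> 'w \<Rightarrow> real ^ 2) \<Rightarrow> (nat \<Rightarrow> 'w \<Rightarrow> real) \<Rightarrow> nat \<Rightarrow> 'w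
    \<Rightarrow> (real ^ 2) set \<Rightarrow> real" where
  "mu_hat X Y N \<omega> B = (1 / real N) * (\<Sum>n=1..N. Y n \<omega> * indicator B (X n \<omega>))"

definition F_hat :: "(nat \<Rightarrow> 'w \<Rightarrow> real ^ 2) \<Rightarrow> nat \<Rightarrow> 'w \<Rightarrow> (real ^ 2) set \<Rightarrow> real" where
  "F_hat X N \<omega> B = (1 / real N) * (\<Sum>n=1..N. indicator B (X n \<omega>))"

definition empirical_estimate :: "(nat \<Rightarrow> (real ^ 2) set set) \<Rightarrow> (nat \<Rightarrow> 'w \<Rightarrow> real ^ 2)
    \<Rightarrow> (nat \<Rightarrow> 'w \<Rightarrow> real) \<Rightarrow> nat \<Rightarrow> 'w \<Rightarrow> real ^ 2 \<Rightarrow> real" where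
  "empirical_estimate Q X Y N \<omega> x =
     (let B = cell (Q N) x in
      if F_hat X N \<omega> B > 0 then mu_hat X Y N \<omega> B / F_hat X N \<omega> B else 0)"

section \<open>Probability\<close>

text \<open>
  The whole family of pairs is i.i.d.: index \<open>0\<close> carries the pair \<open>(X, Y)\<close> at which the estimates
  are evaluated, and the indices \<open>n \<ge> 1\<close> carry the observations \<open>(X\<^sub>n, Y\<^sub>n)\<close>.
\<close>
definition iid_pairs :: "'w measure \<Rightarrow> (nat \<Rightarrow> 'w \<Rightarrow> real ^ 2) \<Rightarrow> (nat \<Rightarrow> 'w \<Rightarrow> real) \<Rightarrow> bool" where
  "iid_pairs M X Y \<longleftrightarrow>
     prob_space.indep_vars M (\<lambda>_. borel) (\<lambda>n \<omega>. (X n \<omega>, Y n \<omega>)) UNIV \<and>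
     (\<forall>n. distr M borel (\<lambda>\<omega>. (X n \<omega>, Y n \<omega>)) = distr M borel (\<lambda>\<omega>. (X 0 \<omega>, Y 0 \<omega>)))"

definition uniform_on_unit_square :: "'w measure \<Rightarrow> ('w \<Rightarrow> real ^ 2) \<Rightarrow> bool" where
  "uniform_on_unit_square M X \<longleftrightarrow>
     X \<in> borel_measurable M \<and> (\<forall>\<omega>\<in>space M. X \<omega> \<in> unit_square) \<and>
     distr M lborel X = uniform_measure lborel unit_square"

text \<open>
  \<open>m\<close> is a version of the function \<open>x \<mapsto> E(Y | X = x)\<close>: the composite of \<open>m\<close> and \<open>X\<close> is a
  version of the conditional expectation of \<open>Y\<close> given the sigma-algebra generated by \<open>X\<close>.
\<close>
definition regression_function ::
    "'w measure \<Rightarrow> ('w \<Rightarrow> real ^ 2) \<Rightarrow> ('w \<Rightarrow> real) \<Rightarrow> (real ^ 2 \<Rightarrow> real) \<Rightarrow> bool" where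
  "regression_function M X Y m \<longleftrightarrow>
     m \<in> borel_measurable (restrict_space borel unit_square) \<and>
     (AE \<omega> in M. m (X \<omega>) = real_cond_exp M (vimage_algebra (space M) X borel) Y \<omega>)"

text \<open>
  Since \<^const>\<open>measure\<close> is \<open>0\<close> on non-measurable sets, measurability of the event is
  required explicitly.
\<close>
definition has_probability :: "'w measure \<Rightarrow> ('w \<Rightarrow> bool) \<Rightarrow> real \<Rightarrow> bool" where
  "has_probability M P p \<longleftrightarrow>
     {\<omega> \<in> space M. P \<omega>} \<in> sets M \<and> \<P>(\<omega> in M. P \<omega>) = p"

section \<open>The metric space of integrable functions modulo almost everywhere equality\<close>

abbreviation square_measure :: "(real ^ 2) measure" where
  "square_measure \<equiv> restrict_space lborel unit_square"

text \<open>
  Elements of \<open>L1_space\<close> are equivalence classes of Borel functions. As every Lebesgue measurable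
  function agrees almost everywhere with a Borel function, this is the usual space. Values of
  functions outside the unit square are irrelevant for the equivalence relation.
\<close>
definition L1_rel :: "((real ^ 2 \<Rightarrow> real) \<times> (real ^ 2 \<Rightarrow> real)) set" where
  "L1_rel = {(f, g). integrable square_measure f \<and> integrable square_measure g \<and>
                     (AE x in square_measure. f x = g x)}"

definition L1_space :: "(real ^ 2 \<Rightarrow> real) set set" where
  "L1_space = {f. integrable square_measure f} // L1_rel"

definition L1_class :: "(real ^ 2 \<Rightarrow> real) \<Rightarrow> (real ^ 2 \<Rightarrow> real) set" where
  "L1_class f = L1_rel `` {f}"

text \<open>The choice of representatives is immaterial, see \<open>L1_dist_class\<close> below.\<close>
definition L1_dist :: "(real ^ 2 \<Rightarrow> real) set \<Rightarrow> (real ^ 2 \<Rightarrow> real) set \<Rightarrow> real" where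
  "L1_dist A B = (LINT x|square_measure. \<bar>(SOME f. f \<in> A) x - (SOME g. g \<in> B) x\<bar>)"

definition L1_topology :: "(real ^ 2 \<Rightarrow> real) set topology" where
  "L1_topology = Metric_space.mtopology L1_space L1_dist"

definition nowhere_dense_in :: "'a topology \<Rightarrow> 'a set \<Rightarrow> bool" where
  "nowhere_dense_in X S \<longleftrightarrow> S \<subseteq> topspace X \<and> X interior_of (X closure_of S) = {}"

definition first_category_in :: "'a topology \<Rightarrow> 'a set \<Rightarrow> bool" where
  "first_category_in X S \<longleftrightarrow>
     (\<exists>\<F>. countable \<F> \<and> (\<forall>A\<in>\<F>. nowhere_dense_in X A) \<and> S = \<Union>\<F>)"

lemma equiv_L1_rel: "equiv {f. integrable square_measure f} L1_rel"
proof (rule equivI)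
  show "L1_rel \<subseteq> {f. integrable square_measure f} \<times> {f. integrable square_measure f}"
    by (auto simp: L1_rel_def)
  show "refl_on {f. integrable square_measure f} L1_rel"
    by (auto simp: L1_rel_def refl_on_def)
  show "sym L1_rel"
    by (auto simp: L1_rel_def sym_def elim: AE_mp)
  show "trans L1_rel"
  proof (rule transI)
    fix f g h assume "(f, g) \<in> L1_rel" "(g, h) \<in> L1_rel"
    then show "(f, h) \<in> L1_rel"
      unfolding L1_rel_def by (auto elim: AE_mp)
  qed
qed

lemma L1_class_some:
  assumes "integrable square_measure f"
  shows "(f, SOME g. g \<in> L1_class f) \<in> L1_rel"
proof -
  have "f \<in> L1_class f"
    using assms by (auto simp: L1_class_def L1_rel_def)
  then have "(SOME g. g \<in> L1_class f) \<in> L1_class f"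
    by (rule someI[where P = "\<lambda>g. g \<in> L1_class f"])
  then show ?thesis by (simp add: L1_class_def)
qed

lemma L1_dist_class:
  assumes "integrable square_measure f" "integrable square_measure g"
  shows "L1_dist (L1_class f) (L1_class g) = (LINT x|square_measure. \<bar>f x - g x\<bar>)"
proof -
  define f' where "f' = (SOME f'. f' \<in> L1_class f)"
  define g' where "g' = (SOME g'. g' \<in> L1_class g)"
  have f': "(f, f') \<in> L1_rel" and g': "(g, g') \<in> L1_rel"
    unfolding f'_def g'_def by (simp_all only: L1_class_some assms)
  have meas: "f' \<in> borel_measurable square_measure" "g' \<in> borel_measurable square_measure"
             "f \<in> borel_measurable square_measure" "g \<in> borel_measurable square_measure"
    using f' g' unfolding L1_rel_def by (simp_all add: borel_measurable_integrable)
  have "AE x in square_measure. f x = f' x" "AE x in square_measure. g x = g' x"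
    using f' g' by (simp_all add: L1_rel_def)
  then have "AE x in square_measure. \<bar>f' x - g' x\<bar> = \<bar>f x - g x\<bar>"
    by eventually_elim simp
  then have "(LINT x|square_measure. \<bar>f' x - g' x\<bar>) = (LINT x|square_measure. \<bar>f x - g x\<bar>)"
    by (intro integral_cong_AE borel_measurable_abs borel_measurable_diff meas)
  then show ?thesis by (simp add: L1_dist_def f'_def g'_def)
qed

lemma L1_class_in_L1_space:
  "integrable square_measure f \<Longrightarrow> L1_class f \<in> L1_space"
  by (auto simp: L1_class_def L1_space_def intro: quotientI)

lemma L1_space_cases:
  assumes "A \<in> L1_space"
  obtains f where "integrable square_measure f" "A = L1_class f"
  using assms by (auto simp: L1_class_def L1_space_def elim: quotientE)

lemma L1_class_eq_iff:
  assumes "integrable square_measure f" "integrable square_measure g"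
  shows "L1_class f = L1_class g \<longleftrightarrow> (AE x in square_measure. f x = g x)"
  using eq_equiv_class_iff[OF equiv_L1_rel, of f g] assms
  by (simp add: L1_class_def L1_rel_def)

lemma Metric_space_L1: "Metric_space L1_space L1_dist"
proof
  fix A B C
  show "0 \<le> L1_dist A B" by (simp add: L1_dist_def)
  show "L1_dist A B = L1_dist B A" by (simp add: L1_dist_def abs_minus_commute)
  assume "A \<in> L1_space" "B \<in> L1_space"
  then obtain f g where f: "integrable square_measure f" "A = L1_class f"
    and g: "integrable square_measure g" "B = L1_class g"
    by (elim L1_space_cases) blast
  show "L1_dist A B = 0 \<longleftrightarrow> A = B"
    using f g integral_nonneg_eq_0_iff_AE[of square_measure "\<lambda>x. \<bar>f x - g x\<bar>"]
    by (simp add: L1_dist_class L1_class_eq_iff)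
  assume "C \<in> L1_space"
  then obtain h where h: "integrable square_measure h" "C = L1_class h"
    by (elim L1_space_cases) blast
  have "(LINT x|square_measure. \<bar>f x - h x\<bar>)
      \<le> (LINT x|square_measure. \<bar>f x - g x\<bar> + \<bar>g x - h x\<bar>)"
    by (rule integral_mono) (use f g h in auto)
  also have "\<dots> = (LINT x|square_measure. \<bar>f x - g x\<bar>) + (LINT x|square_measure. \<bar>g x - h x\<bar>)"
    by (rule Bochner_Integration.integral_add) (use f g h in auto)
  finally show "L1_dist A C \<le> L1_dist A B + L1_dist B C"
    using f g h by (simp add: L1_dist_class)
qed

end

theory Submission
  imports Defs "HOL-Library.Discrete_Functions"
begin

text \<open>
  The example takes \<open>Y = h(X)\<close> for a single integrable function \<open>h \<ge> 0\<close>, so that \<open>h\<close> itself is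
  the regression function. The partitions are grids of congruent dyadic boxes of width \<open>2^-a\<close> and
  height \<open>2^-b\<close>, where \<open>a\<close> and \<open>b\<close> are unrelated; such a grid arises from the square by
  repeated halving, so it is tree-structured.

  Divergence of the cell averages is the failure of strong differentiation in \<open>L\<^sup>1\<close>. Put the value
  \<open>K * 2^L\<close> on the square of side \<open>2^-L\<close> in a corner of the unit square. This spike has integral
  \<open>K * 2^-L\<close>. For every \<open>j \<le> L\<close> the box of width \<open>2^-j\<close> and height \<open>2^-(L-j)\<close> in that corner contains
  the spike and has area \<open>2^-L\<close>, so the average over it is \<open>K\<close>. The union of these boxes is a
  staircase of area at least \<open>L * 2^-(L+1)\<close>. The area on which some box sees an average of at least
  \<open>K\<close> thus exceeds the integral by a factor that grows like \<open>L / K\<close>. Repeating the pattern in \<open>n\<close>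
  successive groups of \<open>L\<close> binary digits of the two coordinates gives independent staircases, which
  miss at most the fraction \<open>(1 - L / 2^(L+1))^n\<close> of the square, while the integral is \<open>n * K * 2^-L\<close>.
  Both quantities are small for suitable \<open>n\<close> and \<open>L\<close> (\<open>spike_function_exists\<close>). A sum of such functions
  with rapidly decreasing integrals and with \<open>K\<close> tending to infinity is the function \<open>h\<close>: by the
  Borel-Cantelli lemma, almost every point lies in grid boxes of arbitrarily large average
  (\<open>oscillating_function_exists\<close>).

  Consistency of the empirical estimate is a matter of speed. For a fixed grid, the strong law of large
  numbers gives convergence of the finitely many cell ratios. If the sequence of partitions stays
  with one grid long enough before it moves on to the next, the estimation error tends to zero almost
  surely along the sequence (\<open>slow_schedule_exists\<close>). Every grid still occurs in it, so the cell
  averages remain unbounded almost everywhere. The strong law is needed under the assumption of a finite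
  mean only: \<open>h\<close> cannot be square integrable, since for square integrable functions the averages over
  shrinking boxes of arbitrary shape converge almost everywhere.

  The set of functions in the last claim consists of nonnegative functions, and the cone of
  nonnegative functions is nowhere dense in \<open>L\<^sup>1\<close> (\<open>nowhere_dense_nonneg_classes\<close>).
\<close>

section \<open>The strong law of large numbers\<close>

locale iid_sequence = prob_space M for M :: "'w measure" +
  fixes Z :: "nat \<Rightarrow> 'w \<Rightarrow> real"
  assumes indep: "indep_vars (\<lambda>_. borel) Z UNIV"
    and identical: "distr M borel (Z n) = distr M borel (Z 0)"
begin

lemma measurable_Z [measurable]: "Z n \<in> borel_measurable M"
  using indep unfolding indep_vars_def by simp

lemma iid_compose:
  assumes [measurable]: "\<phi> \<in> borel_measurable borel"
  shows "iid_sequence M (\<lambda>n \<omega>. \<phi> (Z n \<omega>))"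
proof
  show "indep_vars (\<lambda>_. borel) (\<lambda>n \<omega>. \<phi> (Z n \<omega>)) UNIV"
    by (rule indep_vars_compose2[OF indep]) simp
  have "distr M borel (\<lambda>\<omega>. \<phi> (Z n \<omega>)) = distr (distr M borel (Z n)) borel \<phi>" for n
    by (simp add: distr_distr comp_def)
  then show "distr M borel (\<lambda>\<omega>. \<phi> (Z n \<omega>)) = distr M borel (\<lambda>\<omega>. \<phi> (Z 0 \<omega>))" for n
    by (simp only: identical[of n])
qed

lemma expectation_identical:
  fixes \<phi> :: "real \<Rightarrow> real"
  assumes [measurable]: "\<phi> \<in> borel_measurable borel"
  shows "expectation (\<lambda>\<omega>. \<phi> (Z n \<omega>)) = expectation (\<lambda>\<omega>. \<phi> (Z 0 \<omega>))"
  using integral_distr[of "Z n" M borel \<phi>] integral_distr[of "Z 0" M borel \<phi>]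
  by (simp add: identical[of n])

lemma prob_identical:
  assumes "A \<in> sets borel"
  shows "prob {\<omega>\<in>space M. Z n \<omega> \<in> A} = prob {\<omega>\<in>space M. Z 0 \<omega> \<in> A}"
proof -
  have "prob {\<omega>\<in>space M. Z n \<omega> \<in> A} = measure (distr M borel (Z n)) A" for n
    using assms by (subst measure_distr) (auto intro!: arg_cong[where f = prob])
  then show ?thesis by (metis identical)
qed

definition sample_mean :: "nat \<Rightarrow> 'w \<Rightarrow> real" where
  "sample_mean N \<omega> = (1 / real N) * (\<Sum>n=1..N. Z n \<omega>)"

lemma measurable_sample_mean [measurable]: "sample_mean N \<in> borel_measurable M"
  unfolding sample_mean_def by measurable

text \<open>
  Hoeffding's inequality bounds the probability of a deviation by \<open>e\<close> by a geometric sequence, so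
  the Borel-Cantelli lemma applies without passing to a subsequence of sample sizes.
\<close>
lemma bounded_strong_law:
  assumes bounded: "\<And>\<omega>. Z 0 \<omega> \<in> {0..c}"
  shows "AE \<omega> in M. (\<lambda>N. sample_mean N \<omega>) \<longlonglongrightarrow> expectation (Z 0)"
proof -
  define \<mu> where "\<mu> = expectation (Z 0)"
  have c0: "c \<ge> 0"
    using bounded by force
  \<comment> \<open>Hoeffding's inequality requires an interval of positive length.\<close>
  define b where "b = c + 1"
  have b: "b > 0" using c0 by (simp add: b_def)
  have tail: "AE \<omega> in M. \<forall>\<^sub>F N in sequentially. \<bar>sample_mean N \<omega> - \<mu>\<bar> < e" if "e > 0" for e
  proof -
    define q where "q = exp (-2 * e\<^sup>2 / b\<^sup>2)"
    have q: "0 < q" "q < 1"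
      using that b by (auto simp: q_def)
    define A where "A N = {\<omega>\<in>space M. \<bar>sample_mean N \<omega> - \<mu>\<bar> \<ge> e}" for N
    have [measurable]: "A N \<in> sets M" for N
      unfolding A_def by measurable
    have le: "prob (A N) \<le> 2 * q ^ N" if "N > 0" for N
    proof -
      interpret H: Hoeffding_ineq_iid M "{1..N}" Z "Z 0" 0 b \<mu>
      proof unfold_locales
        show "indep_vars (\<lambda>_. borel) Z {1..N}"
          by (rule indep_vars_subset[OF indep]) simp
        show "AE \<omega> in M. Z 0 \<omega> \<in> {0..b}"
        proof (rule AE_I2)
          show "Z 0 \<omega> \<in> {0..b}" for \<omega>
            using bounded[of \<omega>] by (simp add: b_def)
        qed
      qed (simp_all add: \<mu>_def, rule identical)
      have "prob {\<omega>\<in>space M. \<bar>(\<Sum>n=1..N. Z n \<omega>) / card {1..N} - \<mu>\<bar> \<ge> e}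
          \<le> 2 * exp (-2 * real (card {1..N}) * e\<^sup>2 / (b - 0)\<^sup>2)"
        by (rule H.Hoeffding_ineq_abs_ge') (use \<open>e > 0\<close> b \<open>N > 0\<close> in auto)
      also have "exp (-2 * real (card {1..N}) * e\<^sup>2 / (b - 0)\<^sup>2) = q ^ N"
        unfolding q_def by (subst exp_of_nat_mult[symmetric]) (simp add: field_simps)
      finally show ?thesis
        by (simp add: A_def sample_mean_def)
    qed
    have "summable (\<lambda>N. prob (A N))"
    proof (rule summable_comparison_test_ev)
      show "\<forall>\<^sub>F N in sequentially. norm (prob (A N)) \<le> 2 * q ^ N"
        using eventually_gt_at_top[of 0] by eventually_elim (simp add: le)
      show "summable (\<lambda>N. 2 * q ^ N)"
        using q by (intro summable_mult summable_geometric) auto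
    qed
    then have "AE \<omega> in M. \<forall>\<^sub>F N in sequentially. \<omega> \<in> space M - A N"
      by (intro borel_cantelli_AE1) (auto simp: less_top[symmetric])
    then show ?thesis
      by (auto simp: A_def not_le elim!: eventually_mono AE_mp)
  qed
  have "AE \<omega> in M. \<forall>k::nat. \<forall>\<^sub>F N in sequentially. \<bar>sample_mean N \<omega> - \<mu>\<bar> < 1 / (Suc k)"
    by (subst AE_all_countable) (auto intro!: tail)
  then show ?thesis
  proof eventually_elim
    case (elim \<omega>)
    have "\<forall>\<^sub>F N in sequentially. dist (sample_mean N \<omega>) \<mu> < e" if "e > 0" for e
    proof -
      obtain k where k: "inverse (real (Suc k)) < e"
        using reals_Archimedean[OF \<open>e > 0\<close>] by blast
      show ?thesis
        using elim[rule_format, of k] by eventually_elim (use k in \<open>simp add: dist_real_def inverse_eq_divide\<close>)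
    qed
    then show ?case by (simp add: tendsto_iff \<mu>_def)
  qed
qed

end

text \<open>
  Independent centred variables are orthogonal: the mixed terms of the square have mean zero.
\<close>
lemma (in prob_space) second_moment_centred_sum:
  fixes X :: "'i \<Rightarrow> 'a \<Rightarrow> real"
  assumes "finite I" "indep_vars (\<lambda>_. borel) X I"
    and "\<And>i. i \<in> I \<Longrightarrow> integrable M (\<lambda>\<omega>. (X i \<omega>)\<^sup>2)"
    and "\<And>i. i \<in> I \<Longrightarrow> expectation (X i) = 0"
  shows "integrable M (\<lambda>\<omega>. (\<Sum>i\<in>I. X i \<omega>)\<^sup>2) \<and>
    expectation (\<lambda>\<omega>. (\<Sum>i\<in>I. X i \<omega>)\<^sup>2) = (\<Sum>i\<in>I. expectation (\<lambda>\<omega>. (X i \<omega>)\<^sup>2))"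
  using assms
proof (induction I rule: finite_induct)
  case empty
  then show ?case by simp
next
  case (insert i I)
  define S where "S = (\<lambda>\<omega>. \<Sum>i\<in>I. X i \<omega>)"
  have [measurable]: "X k \<in> borel_measurable M" if "k \<in> insert i I" for k
    using insert.prems(1) that unfolding indep_vars_def by blast
  have S: "integrable M (\<lambda>\<omega>. (S \<omega>)\<^sup>2)"
    "expectation (\<lambda>\<omega>. (S \<omega>)\<^sup>2) = (\<Sum>i\<in>I. expectation (\<lambda>\<omega>. (X i \<omega>)\<^sup>2))"
    unfolding S_def using insert.IH insert.prems indep_vars_subset[OF insert.prems(1)] by auto
  have [measurable]: "S \<in> borel_measurable M" unfolding S_def by measurable
  have int: "integrable M (X i)" "integrable M S"
    using square_integrable_imp_integrable[of S] square_integrable_imp_integrable[of "X i"]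
      S insert.prems by auto
  have ind: "indep_var borel (X i) borel S"
    unfolding S_def using insert.hyps insert.prems by (intro indep_vars_sum) auto
  have cross: "integrable M (\<lambda>\<omega>. X i \<omega> * S \<omega>)" "expectation (\<lambda>\<omega>. X i \<omega> * S \<omega>) = 0"
    using indep_var_integrable[OF ind int] indep_var_lebesgue_integral[OF ind int] insert.prems
    by auto
  have eq: "(\<Sum>i\<in>insert i I. X i \<omega>)\<^sup>2 = (X i \<omega>)\<^sup>2 + 2 * (X i \<omega> * S \<omega>) + (S \<omega>)\<^sup>2" for \<omega>
    using insert.hyps by (simp add: S_def power2_eq_square algebra_simps)
  show ?case
    unfolding eq using insert.hyps insert.prems(2) S cross by simp
qed

text \<open>
  This and the next estimate compare the costs of truncating a variable \<open>t\<close> at the levels \<open>2^r\<close>: a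
  geometric sum is of the order of its largest term, which here is at most of the order of \<open>t\<close>. They
  make a finite mean suffice for the Borel-Cantelli arguments in \<open>eventually_sample_mean_le\<close>.
\<close>
lemma sum_dyadic_below_le:
  fixes t :: real
  assumes "t \<ge> 0"
  shows "(\<Sum>r<R. 2 ^ r * (if 2 ^ r < t then 1 else 0)) \<le> 2 * t"
proof -
  have "(\<Sum>r<R. 2 ^ r * (if 2 ^ r < t then 1 else 0)) \<le> min (2 ^ R) (2 * t)"
    using assms by (induction R) (auto simp: min_def split: if_splits)
  then show ?thesis by simp
qed

lemma sum_dyadic_above_le:
  fixes t :: real
  assumes "t \<ge> 0"
  shows "(\<Sum>r<R. (if t \<le> 2 ^ r then t else 0)\<^sup>2 / 2 ^ r) \<le> 2 * t"
proof -
  have "(\<Sum>r<R. (if t \<le> 2 ^ r then t else 0)\<^sup>2 / 2 ^ r)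
      \<le> (if t \<le> 2 ^ R then 2 * t - 2 * t\<^sup>2 / 2 ^ R else 0)"
  proof (induction R)
    case 0
    then show ?case
      using assms mult_left_le[of t t] by (auto simp: power2_eq_square)
  next
    case (Suc R)
    consider "t \<le> 2 ^ R" | "2 ^ R < t" "t \<le> 2 ^ Suc R" | "2 ^ Suc R < t"
      by linarith
    then show ?case
    proof cases
      case 1
      then have "t \<le> 2 ^ Suc R" by (rule order_trans) simp
      then show ?thesis
        using Suc 1 by simp
    next
      case 2
      then have "t\<^sup>2 \<le> t * 2 ^ Suc R"
        using assms by (simp add: power2_eq_square mult_left_mono del: power_Suc)
      then have "2 * t\<^sup>2 / 2 ^ Suc R \<le> 2 * t"
        by (simp add: field_simps)
      then show ?thesis
        using Suc 2 by simp
    next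
      case 3
      then have "\<not> t \<le> 2 ^ R" "\<not> t \<le> 2 ^ Suc R"
        using power_increasing[of R "Suc R" "2::real"] by (linarith, linarith)
      then show ?thesis using Suc by simp
    qed
  qed
  also have "\<dots> \<le> 2 * t"
    using assms by simp
  finally show ?thesis .
qed

context iid_sequence
begin

text \<open>
  A crude one-sided law for sample sizes \<open>2^r\<close>. The first \<open>2^r\<close> variables are truncated at \<open>2^r\<close>. By
  the two dyadic sums above, the probabilities that some variable exceeds its truncation level are
  summable over \<open>r\<close>, and so are the bounds of Chebyshev's inequality for the truncated sums. A
  sample size between two powers of \<open>2\<close> is rounded up; as the variables are nonnegative, this costs
  at most the factor \<open>2\<close>, which is harmless because the bound is applied to variables with small
  mean.
\<close>
lemma eventually_sample_mean_le:
  assumes nonneg: "\<And>n \<omega>. 0 \<le> Z n \<omega>"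
    and int [simp]: "integrable M (Z 0)" and "\<delta> > 0"
  shows "AE \<omega> in M. \<forall>\<^sub>F N in sequentially. sample_mean N \<omega> \<le> 2 * (expectation (Z 0) + \<delta>)"
proof -
  define \<mu> where "\<mu> = expectation (Z 0)"
  define cut where "cut r t = (if t \<le> 2 ^ r then t else 0)" for r :: nat and t :: real
  have [measurable]: "cut r \<in> borel_measurable borel" for r
    unfolding cut_def by measurable
  have cut_bounds: "0 \<le> cut r (Z n \<omega>)" "cut r (Z n \<omega>) \<le> Z n \<omega>" "cut r (Z n \<omega>) \<le> 2 ^ r" for r n \<omega>
    using nonneg[of n \<omega>] by (auto simp: cut_def)
  have cut_square: "integrable M (\<lambda>\<omega>. (cut r (Z n \<omega>))\<^sup>2)" for r n
    by (rule integrable_const_bound[where B = "(2 ^ r)\<^sup>2"])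
      (use cut_bounds in \<open>auto intro!: AE_I2 power_mono simp: abs_if\<close>)
  have cut_int: "integrable M (\<lambda>\<omega>. cut r (Z n \<omega>))" for r n
    by (rule square_integrable_imp_integrable[OF _ cut_square]) simp
  \<comment> \<open>\<open>A r\<close>: the truncation changes one of the first \<open>2^r\<close> variables. \<open>B r\<close>: their truncated sum
    deviates from its mean by at least \<open>2^r * \<delta>\<close>.\<close>
  define A where "A r = {\<omega>\<in>space M. \<exists>n\<in>{1..2^r}. Z n \<omega> > 2 ^ r}" for r :: nat
  define S where "S r \<omega> = (\<Sum>n=1..2^r. cut r (Z n \<omega>) - expectation (\<lambda>\<omega>. cut r (Z n \<omega>)))"
    for r :: nat and \<omega>
  define B where "B r = {\<omega>\<in>space M. \<bar>S r \<omega>\<bar> \<ge> 2 ^ r * \<delta>}" for r :: nat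
  have [measurable]: "S r \<in> borel_measurable M" for r
    unfolding S_def by measurable
  have [measurable]: "A r \<in> sets M" "B r \<in> sets M" for r
    unfolding A_def B_def by measurable

  have prob_A: "prob (A r) \<le> expectation (\<lambda>\<omega>. 2 ^ r * (if 2 ^ r < Z 0 \<omega> then 1 else 0))" for r
  proof -
    have "prob (A r) \<le> (\<Sum>n\<in>{1..2^r}. prob {\<omega>\<in>space M. Z n \<omega> \<in> {2 ^ r<..}})"
    proof -
      have "A r = (\<Union>n\<in>{1..2^r}. {\<omega>\<in>space M. Z n \<omega> \<in> {2 ^ r<..}})"
        by (auto simp: A_def)
      then show ?thesis
        by (simp del: greaterThan_iff) (intro measure_UNION_le, auto)
    qed
    also have "\<dots> = 2 ^ r * prob {\<omega>\<in>space M. Z 0 \<omega> \<in> {2 ^ r<..}}"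
      by (subst prob_identical) auto
    also have "prob {\<omega>\<in>space M. Z 0 \<omega> \<in> {2 ^ r<..}} = expectation (indicator {\<omega>\<in>space M. Z 0 \<omega> \<in> {2 ^ r<..}})"
      by simp
    also have "\<dots> = expectation (\<lambda>\<omega>. if 2 ^ r < Z 0 \<omega> then 1 else 0)"
      by (intro Bochner_Integration.integral_cong) (auto simp: indicator_def)
    finally show ?thesis by simp
  qed
  have "summable (\<lambda>r. prob (A r))"
  proof (rule summableI_nonneg_bounded)
    fix R
    have "(\<Sum>r<R. prob (A r)) \<le> (\<Sum>r<R. expectation (\<lambda>\<omega>. 2 ^ r * (if 2 ^ r < Z 0 \<omega> then 1 else 0)))"
      by (intro sum_mono prob_A)
    also have "\<dots> = expectation (\<lambda>\<omega>. \<Sum>r<R. 2 ^ r * (if 2 ^ r < Z 0 \<omega> then 1 else 0))"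
      by (intro Bochner_Integration.integral_sum[symmetric] integrable_const_bound) auto
    also have "\<dots> \<le> expectation (\<lambda>\<omega>. 2 * Z 0 \<omega>)"
      by (intro integral_mono Bochner_Integration.integrable_sum sum_dyadic_below_le nonneg)
        (auto intro!: integrable_const_bound)
    finally show "(\<Sum>r<R. prob (A r)) \<le> 2 * \<mu>" by (simp add: \<mu>_def)
  qed simp
  then have "AE \<omega> in M. \<forall>\<^sub>F r in sequentially. \<omega> \<in> space M - A r"
    by (intro borel_cantelli_AE1) (auto simp: less_top[symmetric])
  moreover have prob_B: "prob (B r) \<le> expectation (\<lambda>\<omega>. (cut r (Z 0 \<omega>))\<^sup>2 / 2 ^ r) / \<delta>\<^sup>2" for r
  proof -
    define X where "X = (\<lambda>n \<omega>. cut r (Z n \<omega>) - expectation (\<lambda>\<omega>. cut r (Z n \<omega>)))"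
    have X_square: "integrable M (\<lambda>\<omega>. (X n \<omega>)\<^sup>2)" for n
      using cut_square cut_int by (simp add: X_def power2_diff)
    have X_var: "expectation (\<lambda>\<omega>. (X n \<omega>)\<^sup>2) \<le> expectation (\<lambda>\<omega>. (cut r (Z 0 \<omega>))\<^sup>2)" for n
      using variance_eq[OF cut_int cut_square, of r n]
        expectation_identical[of "\<lambda>t. (cut r t)\<^sup>2" n]
      by (simp add: X_def)
    have X_mean: "expectation (X n) = 0" for n
      using cut_int by (simp add: X_def prob_space)
    have "indep_vars (\<lambda>_. borel) X {1..2^r}"
      unfolding X_def
      by (rule indep_vars_compose2[OF indep_vars_subset[OF indep]]) auto
    then have sums: "integrable M (\<lambda>\<omega>. (\<Sum>n=1..2^r. X n \<omega>)\<^sup>2)"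
        "expectation (\<lambda>\<omega>. (\<Sum>n=1..2^r. X n \<omega>)\<^sup>2) = (\<Sum>n=1..2^r. expectation (\<lambda>\<omega>. (X n \<omega>)\<^sup>2))"
      using second_moment_centred_sum[of "{1..2^r}" X] X_square X_mean by auto
    have S_eq: "S r \<omega> = (\<Sum>n=1..2^r. X n \<omega>)" for \<omega>
      by (simp add: S_def X_def)
    have "prob (B r) \<le> expectation (\<lambda>\<omega>. (S r \<omega>)\<^sup>2) / (2 ^ r * \<delta>)\<^sup>2"
      unfolding B_def
      by (rule second_moment_method) (use sums(1)[folded S_eq] \<open>\<delta> > 0\<close> in \<open>simp_all\<close>)
    also have "expectation (\<lambda>\<omega>. (S r \<omega>)\<^sup>2) \<le> (\<Sum>n\<in>{1..2^r::nat}. expectation (\<lambda>\<omega>. (cut r (Z 0 \<omega>))\<^sup>2))"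
      unfolding S_eq sums(2) by (intro sum_mono X_var)
    also have "\<dots> / (2 ^ r * \<delta>)\<^sup>2 = expectation (\<lambda>\<omega>. (cut r (Z 0 \<omega>))\<^sup>2) / 2 ^ r / \<delta>\<^sup>2"
      by (simp add: power2_eq_square)
    finally show ?thesis
      by (simp add: divide_right_mono)
  qed
  have "summable (\<lambda>r. prob (B r))"
  proof (rule summableI_nonneg_bounded)
    fix R
    have "(\<Sum>r<R. prob (B r)) \<le> (\<Sum>r<R. expectation (\<lambda>\<omega>. (cut r (Z 0 \<omega>))\<^sup>2 / 2 ^ r) / \<delta>\<^sup>2)"
      by (intro sum_mono prob_B)
    also have "\<dots> = expectation (\<lambda>\<omega>. \<Sum>r<R. (cut r (Z 0 \<omega>))\<^sup>2 / 2 ^ r) / \<delta>\<^sup>2"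
      using cut_square by (subst Bochner_Integration.integral_sum) (auto simp: sum_divide_distrib)
    also have "\<dots> \<le> expectation (\<lambda>\<omega>. 2 * Z 0 \<omega>) / \<delta>\<^sup>2"
      using cut_square
      by (intro integral_mono divide_right_mono Bochner_Integration.integrable_sum)
        (auto simp: cut_def intro!: sum_dyadic_above_le nonneg)
    finally show "(\<Sum>r<R. prob (B r)) \<le> 2 * \<mu> / \<delta>\<^sup>2" by (simp add: \<mu>_def)
  qed simp
  then have "AE \<omega> in M. \<forall>\<^sub>F r in sequentially. \<omega> \<in> space M - B r"
    by (intro borel_cantelli_AE1) (auto simp: less_top[symmetric])
  ultimately show ?thesis
  proof eventually_elim
    case (elim \<omega>)
    then have "\<forall>\<^sub>F r in sequentially. \<omega> \<in> space M - A r \<and> \<omega> \<in> space M - B r"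
      by (rule eventually_conj)
    then obtain R where R: "\<omega> \<in> space M - A r" "\<omega> \<in> space M - B r" if "r \<ge> R" for r
      unfolding eventually_sequentially by blast
    have dyadic: "(\<Sum>n=1..2^r. Z n \<omega>) \<le> 2 ^ r * (\<mu> + \<delta>)" if "r \<ge> R" for r
    proof -
      have "(\<Sum>n=1..2^r. Z n \<omega>) = (\<Sum>n=1..2^r. cut r (Z n \<omega>))"
        using R[OF that] by (intro sum.cong) (auto simp: A_def cut_def not_less)
      also have "\<dots> = S r \<omega> + (\<Sum>n\<in>{1..2^r::nat}. expectation (\<lambda>\<omega>. cut r (Z n \<omega>)))"
        by (simp add: S_def sum_subtractf)
      also have "S r \<omega> \<le> 2 ^ r * \<delta>"
        using R[OF that] by (auto simp: B_def)
      also have "(\<Sum>n\<in>{1..2^r::nat}. expectation (\<lambda>\<omega>. cut r (Z n \<omega>))) \<le> (\<Sum>n\<in>{1..2^r::nat}. \<mu>)"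
      proof (rule sum_mono)
        fix n
        have "expectation (\<lambda>\<omega>. cut r (Z n \<omega>)) = expectation (\<lambda>\<omega>. cut r (Z 0 \<omega>))"
          by (rule expectation_identical) simp
        also have "\<dots> \<le> \<mu>"
          unfolding \<mu>_def by (intro integral_mono cut_int int cut_bounds)
        finally show "expectation (\<lambda>\<omega>. cut r (Z n \<omega>)) \<le> \<mu>" .
      qed
      finally show ?thesis by (simp add: algebra_simps)
    qed
    have "sample_mean N \<omega> \<le> 2 * (\<mu> + \<delta>)" if "N \<ge> 2 ^ R" for N
    proof -
      have "N \<ge> 1"
        using that one_le_power[of "2::nat" R] by linarith
      \<comment> \<open>The sample size is rounded up to \<open>2^(r + 1) \<le> 2 * N\<close>.\<close>
      then obtain r where r: "2 ^ r \<le> N" "N < 2 ^ (r + 1)"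
        using ex_power_ivl1[of 2 N] by auto
      have "(2::nat) ^ R < 2 ^ (r + 1)"
        using r that by linarith
      then have "R \<le> r + 1"
        using power_less_imp_less_exp[of "2::nat" R "r + 1"] by simp
      have "(\<Sum>n=1..N. Z n \<omega>) \<le> (\<Sum>n=1..2^(r + 1). Z n \<omega>)"
        using r by (intro sum_mono2) (auto intro: nonneg)
      also have "\<dots> \<le> 2 ^ (r + 1) * (\<mu> + \<delta>)"
        by (rule dyadic) fact
      also have "\<dots> \<le> (2 * real N) * (\<mu> + \<delta>)"
      proof (rule mult_right_mono)
        have "real (2 ^ r) \<le> real N" using r by (subst of_nat_le_iff)
        then show "2 ^ (r + 1) \<le> 2 * real N" by simp
        have "\<mu> \<ge> 0" unfolding \<mu>_def by (simp add: nonneg)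
        then show "0 \<le> \<mu> + \<delta>" using \<open>\<delta> > 0\<close> by simp
      qed
      finally show ?thesis
        using \<open>N \<ge> 1\<close> by (simp add: sample_mean_def field_simps)
    qed
    then show ?case
      unfolding \<mu>_def eventually_sequentially by blast
  qed
qed

text \<open>
  The variables are split at a constant \<open>c\<close>. The bounded parts satisfy the strong law, and the
  excesses over \<open>c\<close> contribute eventually at most a multiple of their mean, which tends to zero with
  growing \<open>c\<close>.
\<close>
theorem strong_law_of_large_numbers:
  assumes nonneg: "\<And>n \<omega>. 0 \<le> Z n \<omega>" and int [simp]: "integrable M (Z 0)"
  shows "AE \<omega> in M. (\<lambda>N. sample_mean N \<omega>) \<longlonglongrightarrow> expectation (Z 0)"
proof -
  define low where "low = (\<lambda>c n \<omega>. min (Z n \<omega>) (real c))"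
  define high where "high = (\<lambda>c n \<omega>. Z n \<omega> - min (Z n \<omega>) (real c))"
  have low: "iid_sequence M (low c)" for c
    unfolding low_def by (rule iid_compose) simp
  have high: "iid_sequence M (high c)" for c
    unfolding high_def by (rule iid_compose[of "\<lambda>t. t - min t (real c)"]) simp
  have int_low: "integrable M (low c 0)" for c
    unfolding low_def by simp
  have int_high: "integrable M (high c 0)" for c
    unfolding high_def by (intro Bochner_Integration.integrable_diff int int_low[unfolded low_def])
  have exp_split: "expectation (Z 0) = expectation (low c 0) + expectation (high c 0)" for c
    using int_low[of c] int by (simp add: low_def high_def)
  have mean_split: "sample_mean N \<omega> =
      iid_sequence.sample_mean (low c) N \<omega> + iid_sequence.sample_mean (high c) N \<omega>" for c N \<omega>
    unfolding sample_mean_def iid_sequence.sample_mean_def[OF low] iid_sequence.sample_mean_def[OF high]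
    by (simp add: low_def high_def sum_subtractf algebra_simps)
  have exp_high: "(\<lambda>c. expectation (high c 0)) \<longlonglongrightarrow> 0"
  proof -
    have "(\<lambda>c. expectation (high c 0)) \<longlonglongrightarrow> expectation (\<lambda>_. 0)"
    proof (rule integral_dominated_convergence[where w = "Z 0"])
      show "AE \<omega> in M. (\<lambda>c. high c 0 \<omega>) \<longlonglongrightarrow> 0"
      proof (rule AE_I2)
        fix \<omega>
        obtain c0 where "Z 0 \<omega> \<le> real c0"
          using real_arch_simple by blast
        then have "\<forall>\<^sub>F c in sequentially. high c 0 \<omega> = 0"
          unfolding eventually_sequentially by (auto simp: high_def intro!: exI[of _ c0])
        then show "(\<lambda>c. high c 0 \<omega>) \<longlonglongrightarrow> 0"
          by (rule tendsto_eventually)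
      qed
      show "AE \<omega> in M. norm (high c 0 \<omega>) \<le> Z 0 \<omega>" for c
        using nonneg by (auto simp: high_def)
    qed (simp_all add: high_def)
    then show ?thesis by simp
  qed
  have "AE \<omega> in M. \<forall>c. (\<lambda>N. iid_sequence.sample_mean (low c) N \<omega>) \<longlonglongrightarrow> expectation (low c 0)"
    unfolding AE_all_countable
  proof
    show "AE \<omega> in M. (\<lambda>N. iid_sequence.sample_mean (low c) N \<omega>) \<longlonglongrightarrow> expectation (low c 0)" for c
      by (rule iid_sequence.bounded_strong_law[OF low, of _ "real c"]) (simp add: low_def nonneg)
  qed
  moreover have "AE \<omega> in M. \<forall>c k. \<forall>\<^sub>F N in sequentially.
      iid_sequence.sample_mean (high c) N \<omega> \<le> 2 * (expectation (high c 0) + 1 / Suc k)"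
    unfolding AE_all_countable
  proof (intro allI)
    show "AE \<omega> in M. \<forall>\<^sub>F N in sequentially.
        iid_sequence.sample_mean (high c) N \<omega> \<le> 2 * (expectation (high c 0) + 1 / Suc k)" for c k
      by (rule iid_sequence.eventually_sample_mean_le[OF high _ int_high]) (simp_all add: high_def)
  qed
  ultimately show ?thesis
  proof eventually_elim
    case (elim \<omega>)
    show ?case
      unfolding tendsto_iff
    proof (intro allI impI)
      fix e :: real assume "e > 0"
      have "\<forall>\<^sub>F c in sequentially. expectation (high c 0) < e / 6"
        using exp_high \<open>e > 0\<close> by (intro order_tendstoD(2)[of _ 0]) auto
      then obtain c where c: "expectation (high c 0) < e / 6"
        by (auto simp: eventually_sequentially)
      obtain k where k: "inverse (real (Suc k)) < e / 6"
        using reals_Archimedean[of "e / 6"] \<open>e > 0\<close> by auto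
      have "\<forall>\<^sub>F N in sequentially. dist (iid_sequence.sample_mean (low c) N \<omega>) (expectation (low c 0)) < e / 6"
        using elim(1) \<open>e > 0\<close> unfolding tendsto_iff by (metis divide_pos_pos zero_less_numeral)
      moreover have "\<forall>\<^sub>F N in sequentially.
          iid_sequence.sample_mean (high c) N \<omega> \<le> 2 * (expectation (high c 0) + 1 / Suc k)"
        using elim(2) by blast
      ultimately show "\<forall>\<^sub>F N in sequentially. dist (sample_mean N \<omega>) (expectation (Z 0)) < e"
      proof eventually_elim
        case (elim N)
        have "0 \<le> iid_sequence.sample_mean (high c) N \<omega>"
          unfolding iid_sequence.sample_mean_def[OF high]
          by (intro mult_nonneg_nonneg sum_nonneg) (auto simp: high_def)
        moreover have "0 \<le> expectation (high c 0)"
          by (intro Bochner_Integration.integral_nonneg) (auto simp: high_def)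
        ultimately show ?case
          using elim c k unfolding mean_split[of N \<omega> c] exp_split[of c] dist_real_def
          by (simp add: inverse_eq_divide abs_if split: if_splits)
      qed
    qed
  qed
qed

end

section \<open>Dyadic grids as tree-structured partitions\<close>

text \<open>
  The number of the interval \<open>(p / 2^a, (p + 1) / 2^a]\<close> that contains \<open>t\<close>; for \<open>0 < t \<le> 1\<close> its binary
  digits are the first \<open>a\<close> digits of the expansion of \<open>t\<close> that does not terminate. Intervals are
  closed on the right because a basic box is cut out by inequalities \<open>\<le>\<close> and \<open>>\<close>.
\<close>
definition dyadic_index :: "nat \<Rightarrow> real \<Rightarrow> nat" where
  "dyadic_index a t = nat (\<lceil>2 ^ a * t\<rceil> - 1)"

definition dyadic_box :: "nat \<Rightarrow> nat \<Rightarrow> nat \<Rightarrow> nat \<Rightarrow> (real ^ 2) set" where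
  "dyadic_box a b p q =
     {x \<in> unit_square. real p / 2 ^ a < x $ 1 \<and> x $ 1 \<le> real (Suc p) / 2 ^ a \<and>
                       real q / 2 ^ b < x $ 2 \<and> x $ 2 \<le> real (Suc q) / 2 ^ b}"

definition dyadic_grid :: "nat \<Rightarrow> nat \<Rightarrow> (real ^ 2) set set" where
  "dyadic_grid a b = (\<lambda>(p, q). dyadic_box a b p q) ` ({..<2 ^ a} \<times> {..<2 ^ b})"

lemma mem_unit_square: "x \<in> unit_square \<longleftrightarrow> 0 < x $ 1 \<and> x $ 1 < 1 \<and> 0 < x $ 2 \<and> x $ 2 < 1"
  by (auto simp: unit_square_def forall_2)

lemma dyadic_index_eq_iff:
  assumes "t > 0"
  shows "dyadic_index a t = p \<longleftrightarrow> real p / 2 ^ a < t \<and> t \<le> real (Suc p) / 2 ^ a"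
proof -
  have "\<lceil>2 ^ a * t\<rceil> \<ge> 1"
    using assms by simp
  then have "dyadic_index a t = p \<longleftrightarrow> \<lceil>2 ^ a * t\<rceil> = int p + 1"
    unfolding dyadic_index_def by linarith
  also have "\<dots> \<longleftrightarrow> real p < 2 ^ a * t \<and> 2 ^ a * t \<le> real p + 1"
    by (simp add: ceiling_eq_iff)
  also have "\<dots> \<longleftrightarrow> real p / 2 ^ a < t \<and> t \<le> real (Suc p) / 2 ^ a"
    by (simp add: field_simps)
  finally show ?thesis .
qed

lemma dyadic_index_less:
  assumes "0 < t" "t < 1"
  shows "dyadic_index a t < 2 ^ a"
proof -
  have "real (dyadic_index a t) / 2 ^ a < t"
    using dyadic_index_eq_iff[of t a] assms by blast
  then have "real (dyadic_index a t) / 2 ^ a < 1"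
    using assms by linarith
  then have "real (dyadic_index a t) < 2 ^ a"
    by simp
  then show ?thesis
    by (metis of_nat_less_iff of_nat_numeral of_nat_power)
qed

text \<open>
  Passing to a coarser level drops the last binary digits of the index. All nesting and counting
  arguments about boxes below reduce to this arithmetic.
\<close>
lemma dyadic_index_div:
  assumes "0 < t"
  shows "dyadic_index (a + c) t div 2 ^ c = dyadic_index a t"
proof -
  define p where "p = dyadic_index (a + c) t"
  define d where "d = p div 2 ^ c"
  have p: "real p / 2 ^ (a + c) < t" "t \<le> real (Suc p) / 2 ^ (a + c)"
    using dyadic_index_eq_iff[OF assms, of "a + c"] unfolding p_def by blast+
  have "d * 2 ^ c \<le> p" "p < Suc d * 2 ^ c"
    by (simp_all add: d_def dividend_less_div_times)
  then have "d * 2 ^ c \<le> p" "Suc p \<le> Suc d * 2 ^ c" by linarith+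
  then have "real (d * 2 ^ c) \<le> real p" "real (Suc p) \<le> real (Suc d * 2 ^ c)"
    by (simp_all only: of_nat_le_iff)
  then have d: "real d * 2 ^ c \<le> real p" "real (Suc p) \<le> real (Suc d) * 2 ^ c"
    by (simp_all only: of_nat_mult of_nat_power of_nat_numeral)
  have "real d / 2 ^ a = real d * 2 ^ c / 2 ^ (a + c)"
    by (simp add: power_add)
  also have "\<dots> \<le> real p / 2 ^ (a + c)"
    using d by (intro divide_right_mono) auto
  finally have "real d / 2 ^ a < t" using p by linarith
  have "real (Suc p) / 2 ^ (a + c) \<le> real (Suc d) * 2 ^ c / 2 ^ (a + c)"
    using d by (intro divide_right_mono) auto
  also have "\<dots> = real (Suc d) / 2 ^ a"
    by (simp add: power_add)
  finally have "t \<le> real (Suc d) / 2 ^ a" using p by linarith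
  with \<open>real d / 2 ^ a < t\<close> have "dyadic_index a t = d"
    using dyadic_index_eq_iff[OF assms] by blast
  then show ?thesis by (simp add: d_def p_def)
qed

lemma dyadic_index_0: "0 < t \<Longrightarrow> t < 1 \<Longrightarrow> dyadic_index 0 t = 0"
  using dyadic_index_less[of t 0] by simp

lemma mem_dyadic_box_iff:
  "x \<in> dyadic_box a b p q \<longleftrightarrow>
     x \<in> unit_square \<and> dyadic_index a (x $ 1) = p \<and> dyadic_index b (x $ 2) = q"
  using dyadic_index_eq_iff[of "x $ 1" a p] dyadic_index_eq_iff[of "x $ 2" b q]
  unfolding dyadic_box_def mem_Collect_eq mem_unit_square by blast

lemma unit_square_eq_dyadic_box: "unit_square = dyadic_box 0 0 0 0"
  by (auto simp: mem_dyadic_box_iff mem_unit_square dyadic_index_0)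

lemma borel_measurable_vec_component [measurable]:
  "(\<lambda>x :: real ^ 'n. x $ i) \<in> borel_measurable borel"
  by (intro borel_measurable_continuous_onI continuous_intros)

lemma unit_square_borel [measurable]: "unit_square \<in> sets borel"
proof -
  have "unit_square = {x \<in> space borel. 0 < x $ 1 \<and> x $ 1 < 1 \<and> 0 < x $ 2 \<and> x $ 2 < (1 :: real)}"
    by (auto simp: mem_unit_square)
  also have "\<dots> \<in> sets borel" by measurable
  finally show ?thesis .
qed

lemma dyadic_index_measurable [measurable]: "dyadic_index a \<in> borel \<rightarrow>\<^sub>M count_space UNIV"
  unfolding dyadic_index_def by measurable

lemma dyadic_box_borel [measurable]: "dyadic_box a b p q \<in> sets borel"
proof -
  have "dyadic_box a b p q =
      {x \<in> space borel. x \<in> unit_square \<and> dyadic_index a (x $ 1) = p \<and> dyadic_index b (x $ 2) = q}"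
    by (auto simp: mem_dyadic_box_iff)
  also have "\<dots> \<in> sets borel" by measurable
  finally show ?thesis .
qed

text \<open>
  The box lies between an open box and the corresponding closed one, which have the same measure.
  The last boxes of a row or column lack a boundary side because the square is open.
\<close>
lemma emeasure_dyadic_box:
  assumes "p < 2 ^ a" "q < 2 ^ b"
  shows "emeasure lborel (dyadic_box a b p q) = ennreal (1 / 2 ^ (a + b))"
proof -
  define l :: "real ^ 2" where "l = (\<chi> i. if i = 1 then real p / 2 ^ a else real q / 2 ^ b)"
  define u :: "real ^ 2" where "u = (\<chi> i. if i = 1 then real (Suc p) / 2 ^ a else real (Suc q) / 2 ^ b)"
  have Basis2: "(Basis :: (real ^ 2) set) = {axis 1 1, axis 2 1}"
    by (auto simp: Basis_vec_def UNIV_2)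
  have le: "l \<bullet> i \<le> u \<bullet> i" if "i \<in> Basis" for i
    using that by (auto simp: Basis2 inner_axis l_def u_def divide_right_mono)
  have prod: "(\<Prod>i\<in>Basis. (u - l) \<bullet> i) = 1 / 2 ^ (a + b)"
    by (simp add: Basis2 axis_eq_axis inner_axis l_def u_def diff_divide_distrib[symmetric] power_add)
  have "real (Suc p) \<le> 2 ^ a" "real (Suc q) \<le> 2 ^ b"
    using assms by (metis Suc_leI of_nat_le_iff of_nat_numeral of_nat_power)+
  then have bounds: "real (Suc p) / 2 ^ a \<le> 1" "real (Suc q) / 2 ^ b \<le> 1"
    by (simp_all add: divide_le_eq)
  have "emeasure lborel (box l u) \<le> emeasure lborel (dyadic_box a b p q)"
  proof (rule emeasure_mono)
    show "box l u \<subseteq> dyadic_box a b p q"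
    proof
      fix x assume "x \<in> box l u"
      then have x: "real p / 2 ^ a < x $ 1" "x $ 1 < real (Suc p) / 2 ^ a"
          "real q / 2 ^ b < x $ 2" "x $ 2 < real (Suc q) / 2 ^ b"
        by (auto simp: mem_box_cart forall_2 l_def u_def)
      moreover have "0 \<le> real p / 2 ^ a" "0 \<le> real q / 2 ^ b" by simp_all
      ultimately show "x \<in> dyadic_box a b p q"
        using bounds unfolding dyadic_box_def mem_Collect_eq mem_unit_square by linarith
    qed
  qed simp
  moreover have "emeasure lborel (dyadic_box a b p q) \<le> emeasure lborel (cbox l u)"
    by (rule emeasure_mono) (auto simp: dyadic_box_def mem_box_cart forall_2 l_def u_def)
  moreover have "emeasure lborel (box l u) = ennreal (\<Prod>i\<in>Basis. (u - l) \<bullet> i)"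
    by (rule emeasure_lborel_box) (rule le)
  moreover have "emeasure lborel (cbox l u) = ennreal (\<Prod>i\<in>Basis. (u - l) \<bullet> i)"
    by (rule emeasure_lborel_cbox) (rule le)
  ultimately show ?thesis
    unfolding prod by simp
qed

lemma measure_dyadic_box:
  assumes "p < 2 ^ a" "q < 2 ^ b"
  shows "measure lborel (dyadic_box a b p q) = 1 / 2 ^ (a + b)"
  using emeasure_dyadic_box[OF assms] by (simp add: measure_def)

lemma emeasure_unit_square [simp]: "emeasure lborel unit_square = 1"
  using emeasure_dyadic_box[of 0 0 0 0] by (simp add: unit_square_eq_dyadic_box)

lemma dyadic_box_nonempty:
  assumes "p < 2 ^ a" "q < 2 ^ b"
  shows "dyadic_box a b p q \<noteq> {}"
  using emeasure_dyadic_box[OF assms] by auto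

lemma dyadic_index_unit_square:
  assumes "x \<in> unit_square"
  shows "dyadic_index a (x $ i) < 2 ^ a"
  using assms by (intro dyadic_index_less) (auto simp: unit_square_def)

lemma finite_dyadic_grid [simp]: "finite (dyadic_grid a b)"
  by (simp add: dyadic_grid_def)

lemma dyadic_grid_borel: "B \<in> dyadic_grid a b \<Longrightarrow> B \<in> sets borel"
  by (auto simp: dyadic_grid_def)

lemma emeasure_dyadic_grid: "B \<in> dyadic_grid a b \<Longrightarrow> emeasure lborel B = ennreal (1 / 2 ^ (a + b))"
  by (auto simp: dyadic_grid_def emeasure_dyadic_box)

lemma dyadic_box_in_grid:
  "x \<in> unit_square \<Longrightarrow>
   dyadic_box a b (dyadic_index a (x $ 1)) (dyadic_index b (x $ 2)) \<in> dyadic_grid a b"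
  by (force simp: dyadic_grid_def dyadic_index_unit_square)

lemma cell_dyadic_grid:
  assumes "x \<in> unit_square"
  shows "cell (dyadic_grid a b) x = dyadic_box a b (dyadic_index a (x $ 1)) (dyadic_index b (x $ 2))"
  unfolding cell_def
proof (rule the_equality)
  show "dyadic_box a b (dyadic_index a (x $ 1)) (dyadic_index b (x $ 2)) \<in> dyadic_grid a b \<and>
      x \<in> dyadic_box a b (dyadic_index a (x $ 1)) (dyadic_index b (x $ 2))"
    using assms dyadic_box_in_grid by (simp add: mem_dyadic_box_iff)
qed (auto simp: dyadic_grid_def mem_dyadic_box_iff)

lemma cell_in_dyadic_grid: "x \<in> unit_square \<Longrightarrow> cell (dyadic_grid a b) x \<in> dyadic_grid a b"
  by (simp add: cell_dyadic_grid dyadic_box_in_grid)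

lemma mem_cell_dyadic_grid: "x \<in> unit_square \<Longrightarrow> x \<in> cell (dyadic_grid a b) x"
  by (simp add: cell_dyadic_grid mem_dyadic_box_iff)

lemma cell_dyadic_grid_eq:
  assumes "B \<in> dyadic_grid a b" "x \<in> B"
  shows "cell (dyadic_grid a b) x = B"
proof -
  obtain p q where "B = dyadic_box a b p q"
    using assms by (auto simp: dyadic_grid_def)
  then show ?thesis
    using assms by (simp add: cell_dyadic_grid mem_dyadic_box_iff)
qed

lemma basic_box_dyadic_box:
  assumes "p < 2 ^ a" "q < 2 ^ b"
  shows "basic_box (dyadic_box a b p q)"
proof -
  define L :: "((real ^ 2) \<times> real) set" where
    "L = {(axis 1 1, real (Suc p) / 2 ^ a), (axis 2 1, real (Suc q) / 2 ^ b)}"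
  define G :: "((real ^ 2) \<times> real) set" where
    "G = {(axis 1 1, real p / 2 ^ a), (axis 2 1, real q / 2 ^ b)}"
  have "finite L" "finite G" "\<forall>(b, c) \<in> L \<union> G. \<exists>!i. b $ i \<noteq> 0"
    by (auto simp: L_def G_def axis_def)
  moreover have "dyadic_box a b p q =
      {x \<in> unit_square. (\<forall>(b, c) \<in> L. b \<bullet> x \<le> c) \<and> (\<forall>(b, c) \<in> G. b \<bullet> x > c)}"
    by (auto simp: dyadic_box_def L_def G_def inner_axis')
  ultimately show ?thesis
    unfolding basic_box_def using dyadic_box_nonempty[OF assms] by blast
qed

lemma finite_box_partition_dyadic_grid: "finite_box_partition (dyadic_grid a b)"
  unfolding finite_box_partition_def
proof (intro conjI ballI)
  show "partition_on unit_square (dyadic_grid a b)"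
  proof (rule partition_onI)
    show "\<Union> (dyadic_grid a b) = unit_square"
    proof
      show "\<Union> (dyadic_grid a b) \<subseteq> unit_square"
        by (auto simp: dyadic_grid_def dyadic_box_def)
      show "unit_square \<subseteq> \<Union> (dyadic_grid a b)"
        using cell_in_dyadic_grid mem_cell_dyadic_grid by blast
    qed
    show "disjnt B C" if "B \<in> dyadic_grid a b" "C \<in> dyadic_grid a b" "B \<noteq> C" for B C
      using that cell_dyadic_grid_eq[of B a b] cell_dyadic_grid_eq[of C a b]
      by (metis disjnt_iff)
    show "{} \<notin> dyadic_grid a b"
      using dyadic_box_nonempty unfolding dyadic_grid_def by fastforce
  qed
  show "basic_box B" if "B \<in> dyadic_grid a b" for B
    using that by (auto simp: dyadic_grid_def basic_box_dyadic_box)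
qed simp

lemma diameter_dyadic_box_le: "diameter (dyadic_box a b p q) \<le> 1 / 2 ^ a + 1 / 2 ^ b"
proof (rule diameter_le)
  fix x y assume xy: "x \<in> dyadic_box a b p q" "y \<in> dyadic_box a b p q"
  have "norm (x - y) \<le> \<bar>x $ 1 - y $ 1\<bar> + \<bar>x $ 2 - y $ 2\<bar>"
    using norm_le_l1_cart[of "x - y"] by (simp add: sum_2)
  also have "\<bar>x $ 1 - y $ 1\<bar> \<le> 1 / 2 ^ a"
    using xy by (auto simp: dyadic_box_def add_divide_distrib abs_le_iff)
  also have "\<bar>x $ 2 - y $ 2\<bar> \<le> 1 / 2 ^ b"
    using xy by (auto simp: dyadic_box_def add_divide_distrib abs_le_iff)
  finally show "norm (x - y) \<le> 1 / 2 ^ a + 1 / 2 ^ b" by simp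
qed simp

lemma partition_norm_dyadic_grid:
  "0 \<le> partition_norm (dyadic_grid a b)" "partition_norm (dyadic_grid a b) \<le> 1 / 2 ^ a + 1 / 2 ^ b"
proof -
  define D where "D = (\<lambda>x. diameter (cell (dyadic_grid a b) x)) ` unit_square"
  have "D \<subseteq> diameter ` dyadic_grid a b"
    using cell_in_dyadic_grid by (auto simp: D_def)
  then have fin: "finite D"
    by (rule finite_subset) simp
  have D: "0 \<le> d \<and> d \<le> 1 / 2 ^ a + 1 / 2 ^ b" if "d \<in> D" for d
  proof -
    from that obtain x where x: "x \<in> unit_square" "d = diameter (cell (dyadic_grid a b) x)"
      by (auto simp: D_def)
    have "bounded (cell (dyadic_grid a b) x)"
      by (rule bounded_subset[of "cbox 0 1"])
        (use x in \<open>auto simp: cell_dyadic_grid dyadic_box_def unit_square_def mem_box_cart less_imp_le\<close>)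
    then show ?thesis
      using x diameter_ge_0 by (simp add: cell_dyadic_grid diameter_dyadic_box_le)
  qed
  have "D \<noteq> {}"
    using dyadic_box_nonempty[of 0 0 0 0] by (simp add: D_def unit_square_eq_dyadic_box)
  then have "Max D \<in> D" using fin by simp
  then show "0 \<le> partition_norm (dyadic_grid a b)"
      "partition_norm (dyadic_grid a b) \<le> 1 / 2 ^ a + 1 / 2 ^ b"
    using D unfolding partition_norm_def D_def[symmetric] by auto
qed

text \<open>
  The boxes of the halving tree in the numbering of a binary heap: the root is \<open>1\<close>, the children of
  \<open>t\<close> are \<open>2 * t\<close> and \<open>2 * t + 1\<close>, and the nodes of depth \<open>d\<close> are \<open>2^d + r\<close> for \<open>r < 2^d\<close>. The first
  \<open>a\<close> cuts halve the width, all later ones the height; so at depth \<open>d\<close> the height has been halved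
  \<open>d - a\<close> times (truncated subtraction), and the digits of \<open>r\<close> are those of the column followed by
  those of the row.
\<close>
definition heap_box :: "nat \<Rightarrow> nat \<Rightarrow> (real ^ 2) set" where
  "heap_box a t =
     (let d = floor_log t; r = t - 2 ^ d; b = d - a
      in dyadic_box (d - b) b (r div 2 ^ b) (r mod 2 ^ b))"

lemma heap_decomposition:
  assumes "t \<ge> 1"
  obtains d r where "t = 2 ^ d + r" "r < 2 ^ d" "floor_log t = d"
proof -
  have "2 ^ floor_log t \<le> t" "t < 2 * 2 ^ floor_log t"
    using assms floor_log_exp2_le floor_log_exp2_gt by auto
  then show thesis
    by (intro that[of "floor_log t" "t - 2 ^ floor_log t"]) auto
qed

lemma floor_log_heap:
  assumes "r < 2 ^ d"
  shows "floor_log (2 ^ d + r) = d"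
  using assms by (intro floor_log_eqI) auto

lemma heap_box_eq:
  assumes "r < 2 ^ d"
  shows "heap_box a (2 ^ d + r) =
    dyadic_box (d - (d - a)) (d - a) (r div 2 ^ (d - a)) (r mod 2 ^ (d - a))"
  by (simp add: heap_box_def floor_log_heap[OF assms] Let_def)

lemma dyadic_index_div_2: "0 < t \<Longrightarrow> dyadic_index a t = dyadic_index (Suc a) t div 2"
  using dyadic_index_div[of t a 1] by simp

lemma heap_box_split:
  assumes "t \<ge> 1"
  shows "heap_box a t = heap_box a (2 * t) \<union> heap_box a (2 * t + 1)"
    and "heap_box a (2 * t) \<inter> heap_box a (2 * t + 1) = {}"
proof -
  obtain d r where t: "t = 2 ^ d + r" and r: "r < 2 ^ d"
    using heap_decomposition[OF assms] by metis
  have children: "2 * t = 2 ^ Suc d + 2 * r" "2 * t + 1 = 2 ^ Suc d + (2 * r + 1)"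
    and less: "2 * r < 2 ^ Suc d" "2 * r + 1 < 2 ^ Suc d"
    using t r by auto
  have "heap_box a t = heap_box a (2 * t) \<union> heap_box a (2 * t + 1) \<and>
      heap_box a (2 * t) \<inter> heap_box a (2 * t + 1) = {}"
  proof (cases "d < a")
    case True
    then have "d - a = 0" "Suc d - a = 0" by auto
    then show ?thesis
      unfolding children(2) unfolding children(1) unfolding t heap_box_eq[OF r] heap_box_eq[OF less(1)] heap_box_eq[OF less(2)]
      by (auto simp: mem_dyadic_box_iff mem_unit_square dyadic_index_div_2[of _ d] dyadic_index_0)
  next
    case False
    then have "Suc d - a = Suc (d - a)" "Suc d - Suc (d - a) = d - (d - a)" by auto
    moreover have "(2 * r + 1) mod (2 * 2 ^ (d - a)) = 2 * (r mod 2 ^ (d - a)) + 1"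
      using mod_mult2_eq[of "2 * r + 1" 2 "2 ^ (d - a)"] by simp
    moreover have "(2 * r + 1) div (2 * 2 ^ (d - a)) = r div 2 ^ (d - a)"
      using div_mult2_eq[of "2 * r + 1" 2 "2 ^ (d - a)"] by simp
    moreover have "k div 2 = v \<longleftrightarrow> k = 2 * v \<or> k = 2 * v + 1" for k v :: nat
      by linarith
    ultimately show ?thesis
      unfolding children(2) unfolding children(1) unfolding t heap_box_eq[OF r] heap_box_eq[OF less(1)] heap_box_eq[OF less(2)]
      by (auto simp: mem_dyadic_box_iff mem_unit_square dyadic_index_div_2[of _ "d - a"])
  qed
  then show "heap_box a t = heap_box a (2 * t) \<union> heap_box a (2 * t + 1)"
    "heap_box a (2 * t) \<inter> heap_box a (2 * t + 1) = {}" by auto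
qed

lemma basic_box_heap_box:
  assumes "t \<ge> 1"
  shows "basic_box (heap_box a t)"
proof -
  obtain d r where t: "t = 2 ^ d + r" and r: "r < 2 ^ d"
    using heap_decomposition[OF assms] by metis
  have "r < 2 ^ (d - (d - a)) * 2 ^ (d - a)"
    using r by (simp add: power_add[symmetric])
  then have "r div 2 ^ (d - a) < 2 ^ (d - (d - a))"
    by (simp add: less_mult_imp_div_less)
  then show ?thesis
    unfolding t heap_box_eq[OF r] by (intro basic_box_dyadic_box) auto
qed

lemma bij_betw_heap_box_leaves:
  "bij_betw (heap_box a) {2 ^ (a + b)..<2 ^ Suc (a + b)} (dyadic_grid a b)"
proof -
  have leaf: "heap_box a (2 ^ (a + b) + r) = dyadic_box a b (r div 2 ^ b) (r mod 2 ^ b)"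
    and index: "r div 2 ^ b < 2 ^ a" if "r < 2 ^ (a + b)" for r :: nat
    using heap_box_eq[OF that, of a] that by (simp_all add: power_add less_mult_imp_div_less)
  have "bij_betw (\<lambda>r. heap_box a (2 ^ (a + b) + r)) {..<2 ^ (a + b)} (dyadic_grid a b)"
  proof (rule bij_betwI')
    fix r s assume r: "r \<in> {..<(2::nat) ^ (a + b)}" and s: "s \<in> {..<(2::nat) ^ (a + b)}"
    show "heap_box a (2 ^ (a + b) + r) = heap_box a (2 ^ (a + b) + s) \<longleftrightarrow> r = s"
    proof
      assume eq: "heap_box a (2 ^ (a + b) + r) = heap_box a (2 ^ (a + b) + s)"
      obtain x where x: "x \<in> dyadic_box a b (r div 2 ^ b) (r mod 2 ^ b)"
        using dyadic_box_nonempty[of "r div 2 ^ b" a "r mod 2 ^ b" b] index[of r] r by auto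
      then have "x \<in> dyadic_box a b (s div 2 ^ b) (s mod 2 ^ b)"
        using eq leaf[of r] leaf[of s] r s by simp
      then have "r div 2 ^ b = s div 2 ^ b" "r mod 2 ^ b = s mod 2 ^ b"
        using x by (auto simp: mem_dyadic_box_iff)
      then show "r = s" by (metis div_mult_mod_eq)
    qed simp
  next
    fix r assume "r \<in> {..<(2::nat) ^ (a + b)}"
    then show "heap_box a (2 ^ (a + b) + r) \<in> dyadic_grid a b"
      using leaf[of r] index[of r] by (force simp: dyadic_grid_def)
  next
    fix B assume "B \<in> dyadic_grid a b"
    then obtain p q where pq: "p < 2 ^ a" "q < 2 ^ b" "B = dyadic_box a b p q"
      by (auto simp: dyadic_grid_def)
    define r where "r = p * 2 ^ b + q"
    have "r < Suc p * 2 ^ b" using pq by (simp add: r_def)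
    also have "\<dots> \<le> 2 ^ a * 2 ^ b" using pq by (intro mult_right_mono) auto
    finally have "r < 2 ^ (a + b)" by (simp add: power_add)
    moreover have "r div 2 ^ b = p" "r mod 2 ^ b = q" using pq by (simp_all add: r_def)
    ultimately show "\<exists>r\<in>{..<2 ^ (a + b)}. B = heap_box a (2 ^ (a + b) + r)"
      using leaf[of r] pq by (intro bexI[of _ r]) auto
  qed
  moreover have "bij_betw (\<lambda>t. t - 2 ^ (a + b)) {2 ^ (a + b)..<2 ^ Suc (a + b)} {..<(2::nat) ^ (a + b)}"
    by (rule bij_betw_byWitness[where f' = "\<lambda>r. 2 ^ (a + b) + r"]) auto
  ultimately have "bij_betw ((\<lambda>r. heap_box a (2 ^ (a + b) + r)) \<circ> (\<lambda>t. t - 2 ^ (a + b)))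
      {2 ^ (a + b)..<2 ^ Suc (a + b)} (dyadic_grid a b)"
    by (rule bij_betw_trans[rotated])
  then show ?thesis
    by (rule bij_betw_cong[THEN iffD1, rotated]) auto
qed

lemma tree_structured_dyadic_grid: "tree_structured_partition (dyadic_grid a b)"
proof -
  define D where "D = a + b"
  define T where "T = {1..<(2::nat) ^ Suc D}"
  define left where "left t = (if t < 2 ^ D then 2 * t else 0)" for t :: nat
  define right where "right t = (if t < 2 ^ D then 2 * t + 1 else 0)" for t :: nat
  have T1: "1 \<in> T"
    using one_less_power[of "2::nat" "Suc D"] by (simp add: T_def)
  have MinT: "Min T = 1"
    using T1 by (intro Min_eqI) (auto simp: T_def)
  have leaves: "terminal_nodes T left right = {2 ^ D..<2 ^ Suc D}"
    by (auto simp: terminal_nodes_def T_def left_def right_def not_less Suc_le_eq)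
  have "finite_rooted_binary_tree T left right"
    unfolding finite_rooted_binary_tree_def
  proof (intro conjI ballI impI)
    fix t assume t: "t \<in> T"
    show "left t \<in> T \<union> {0}" "right t \<in> T \<union> {0}"
      using t by (auto simp: T_def left_def right_def)
    show "left t = 0 \<and> right t = 0 \<or> t < left t \<and> t < right t"
      using t by (auto simp: T_def left_def right_def)
    assume "t \<noteq> Min T"
    then have t2: "t \<ge> 2" using t unfolding MinT by (auto simp: T_def)
    show "\<exists>!s. s \<in> T \<and> (t = left s \<or> t = right s)"
    proof (rule ex1I[of _ "t div 2"])
      have "t div 2 < 2 ^ D" using t by (auto simp: T_def)
      then show "t div 2 \<in> T \<and> (t = left (t div 2) \<or> t = right (t div 2))"
        using t2 by (auto simp: T_def left_def right_def)
      show "s = t div 2" if "s \<in> T \<and> (t = left s \<or> t = right s)" for s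
        using that t2 by (auto simp: left_def right_def split: if_splits)
    qed
  qed (use T1 in \<open>auto simp: T_def\<close>)
  moreover have "heap_box a (Min T) = unit_square"
    using heap_box_eq[of 0 0 a] by (simp add: MinT unit_square_eq_dyadic_box)
  moreover have "\<forall>t\<in>T. basic_box (heap_box a t)"
    by (auto simp: T_def intro: basic_box_heap_box)
  moreover have "\<forall>t\<in>T - terminal_nodes T left right.
      heap_box a t = heap_box a (left t) \<union> heap_box a (right t) \<and>
      heap_box a (left t) \<inter> heap_box a (right t) = {}"
  proof
    fix t assume "t \<in> T - terminal_nodes T left right"
    then have "t \<ge> 1" "left t = 2 * t" "right t = 2 * t + 1"
      unfolding leaves by (auto simp: T_def left_def right_def)
    then show "heap_box a t = heap_box a (left t) \<union> heap_box a (right t) \<and>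
        heap_box a (left t) \<inter> heap_box a (right t) = {}"
      using heap_box_split by metis
  qed
  moreover have "bij_betw (heap_box a) (terminal_nodes T left right) (dyadic_grid a b)"
    unfolding leaves D_def by (rule bij_betw_heap_box_leaves)
  ultimately show ?thesis
    unfolding tree_structured_partition_def using finite_box_partition_dyadic_grid by blast
qed

section \<open>Spikes seen by eccentric boxes\<close>

lemma cell_average_mono:
  assumes x: "x \<in> unit_square" and fg: "integrable lborel f" "integrable lborel g"
    and le: "AE u in lborel. f u \<le> g u"
  shows "cell_average (dyadic_grid a b) f x \<le> cell_average (dyadic_grid a b) g x"
proof -
  have [measurable]: "cell (dyadic_grid a b) x \<in> sets lborel"
    using dyadic_grid_borel[OF cell_in_dyadic_grid[OF x]] by simp
  have "(LINT u:cell (dyadic_grid a b) x|lborel. f u) \<le> (LINT u:cell (dyadic_grid a b) x|lborel. g u)"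
    unfolding set_lebesgue_integral_def
  proof (rule integral_mono_AE)
    show "AE u in lborel. indicator (cell (dyadic_grid a b) x) u *\<^sub>R f u
        \<le> indicator (cell (dyadic_grid a b) x) u *\<^sub>R g u"
      using le by eventually_elim (simp add: indicator_def)
  qed (intro integrable_mult_indicator fg, measurable)+
  then show ?thesis
    unfolding cell_average_def by (intro mult_left_mono) auto
qed

text \<open>
  The union of those squares of side \<open>2^-a\<close> whose index pair belongs to \<open>W\<close>. Areas of such unions
  become cardinalities of sets of index pairs.
\<close>
definition level_set :: "nat \<Rightarrow> (nat \<times> nat) set \<Rightarrow> (real ^ 2) set" where
  "level_set a W = {x \<in> unit_square. (dyadic_index a (x $ 1), dyadic_index a (x $ 2)) \<in> W}"

definition level_indices :: "nat \<Rightarrow> (nat \<times> nat) set" where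
  "level_indices a = {..<2 ^ a} \<times> {..<2 ^ a}"

definition last_digits :: "nat \<Rightarrow> nat \<times> nat \<Rightarrow> nat \<times> nat" where
  "last_digits L = (\<lambda>(p, q). (p mod 2 ^ L, q mod 2 ^ L))"

definition drop_digits :: "nat \<Rightarrow> nat \<times> nat \<Rightarrow> nat \<times> nat" where
  "drop_digits L = (\<lambda>(p, q). (p div 2 ^ L, q div 2 ^ L))"

lemma finite_level_indices [simp]: "finite (level_indices a)"
  by (simp add: level_indices_def)

lemma card_level_indices: "card (level_indices a) = 4 ^ a"
  by (simp add: level_indices_def power_mult_distrib[symmetric])

lemma level_set_borel [measurable]: "level_set a W \<in> sets borel"
proof -
  have "level_set a W = {x \<in> space borel. x \<in> unit_square \<and>
      (\<exists>(p, q) \<in> W. dyadic_index a (x $ 1) = p \<and> dyadic_index a (x $ 2) = q)}"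
    by (auto simp: level_set_def)
  also have "\<dots> \<in> sets borel"
    by measurable
  finally show ?thesis .
qed

lemma measure_level_set:
  assumes "W \<subseteq> level_indices a"
  shows "measure lborel (level_set a W) = card W / 4 ^ a"
proof -
  have fin: "finite W" by (rule finite_subset[OF assms]) simp
  have "level_set a W = (\<Union>(p, q)\<in>W. dyadic_box a a p q)"
    by (auto simp: level_set_def mem_dyadic_box_iff)
  also have "measure lborel \<dots> = (\<Sum>(p, q)\<in>W. measure lborel (dyadic_box a a p q))"
  proof (subst measure_finite_Union[OF fin])
    show "disjoint_family_on (\<lambda>(p, q). dyadic_box a a p q) W"
      by (auto simp: disjoint_family_on_def mem_dyadic_box_iff)
    show "emeasure lborel (case w of (p, q) \<Rightarrow> dyadic_box a a p q) \<noteq> \<infinity>" if "w \<in> W" for w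
      using that assms by (auto simp: level_indices_def emeasure_dyadic_box)
  qed (auto simp: case_prod_unfold)
  also have "\<dots> = (\<Sum>w\<in>W. 1 / 4 ^ a)"
    using assms
    by (intro sum.cong)
      (auto simp: level_indices_def measure_dyadic_box power_add power_mult_distrib[symmetric])
  finally show ?thesis by simp
qed

text \<open>
  Independence of digits in combinatorial form: the leading and the last digits of an index can be
  prescribed separately, so cardinalities multiply.
\<close>
lemma card_refined_indices:
  assumes W: "W \<subseteq> level_indices a" and D: "D \<subseteq> level_indices L"
  shows "{w. drop_digits L w \<in> W \<and> last_digits L w \<in> D} \<subseteq> level_indices (a + L)" (is "?R \<subseteq> _")
    and "card {w. drop_digits L w \<in> W \<and> last_digits L w \<in> D} = card W * card D"
proof -
  show "?R \<subseteq> level_indices (a + L)"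
    using W by (auto simp: drop_digits_def level_indices_def power_add div_less_iff_less_mult)
  have D_less: "u < 2 ^ L" "v < 2 ^ L" if "(u, v) \<in> D" for u v
    using D that by (auto simp: level_indices_def)
  define join where
    "join = (\<lambda>((p, q), (u, v)). (p * 2 ^ L + u, q * 2 ^ L + v) :: nat \<times> nat)"
  have split_join: "drop_digits L (join (w, d)) = w" "last_digits L (join (w, d)) = d" if "d \<in> D" for w d
    using D_less[of "fst d" "snd d"] that
    by (auto simp: join_def drop_digits_def last_digits_def case_prod_unfold)
  have join_split: "join (drop_digits L w, last_digits L w) = w" for w
    by (simp add: join_def drop_digits_def last_digits_def case_prod_unfold div_mult_mod_eq)
  have "bij_betw (\<lambda>w. (drop_digits L w, last_digits L w)) ?R (W \<times> D)"
    by (rule bij_betw_byWitness[where f' = join]) (auto simp: split_join join_split)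
  then show "card ?R = card W * card D"
    by (simp add: bij_betw_same_card card_cartesian_product)
qed

text \<open>
  The points for which the group of \<open>L\<close> binary digits after the first \<open>a\<close> digits of the two
  coordinates, read as a pair of numbers, belongs to \<open>D\<close>.
\<close>
definition block_set :: "nat \<Rightarrow> nat \<Rightarrow> (nat \<times> nat) set \<Rightarrow> (real ^ 2) set" where
  "block_set a L D = level_set (a + L) {w. last_digits L w \<in> D}"

lemma block_set_borel [measurable]: "block_set a L D \<in> sets borel"
  by (simp add: block_set_def)

lemma level_set_Int_block_set:
  "level_set a W \<inter> block_set a L D = level_set (a + L) {w. drop_digits L w \<in> W \<and> last_digits L w \<in> D}"
  by (auto simp: level_set_def block_set_def drop_digits_def mem_unit_square dyadic_index_div)

lemma level_set_all: "level_set a (level_indices a) = unit_square"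
  by (auto simp: level_set_def level_indices_def dyadic_index_unit_square)

lemma measure_block_set:
  assumes "D \<subseteq> level_indices L"
  shows "measure lborel (block_set a L D) = card D / 4 ^ L"
proof -
  have "block_set a L D = level_set a (level_indices a) \<inter> block_set a L D"
    unfolding level_set_all by (auto simp: block_set_def level_set_def)
  then show ?thesis
    unfolding level_set_Int_block_set
    using card_refined_indices[OF order_refl assms, of a]
    by (simp add: measure_level_set card_level_indices power_add)
qed

text \<open>
  The pairs in which, for some \<open>j\<close>, the first \<open>j\<close> of the \<open>L\<close> digits of the first number and the first
  \<open>L - j\<close> digits of the second number are zero. This is the union of the boxes of width \<open>2^-j\<close> and
  height \<open>2^-(L-j)\<close> at a corner, measured in units of \<open>2^-L\<close>.
\<close>
definition staircase :: "nat \<Rightarrow> (nat \<times> nat) set" where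
  "staircase L = {(u, v) \<in> level_indices L. \<exists>j<L. u < 2 ^ (L - j) \<and> v < 2 ^ j}"

lemma staircase_subset: "staircase L \<subseteq> level_indices L"
  by (auto simp: staircase_def)

text \<open>
  The box with parameter \<open>j\<close> has \<open>2^L\<close> elements, and its right half is disjoint from all boxes with
  larger parameters. The \<open>L\<close> right halves together account for \<open>L * 2^(L-1)\<close> elements.
\<close>
lemma card_staircase_ge: "L * 2 ^ L \<le> 2 * card (staircase L)"
proof -
  \<comment> \<open>The right half of the box with parameter \<open>j\<close>.\<close>
  define R where "R j = {(2::nat) ^ (L - Suc j)..<2 ^ (L - j)} \<times> {..<(2::nat) ^ j}" for j :: nat
  have card_R: "2 * card (R j) = 2 ^ L" if "j < L" for j
  proof -
    have "L = Suc (L - Suc j) + j" "L - j = Suc (L - Suc j)" using that by auto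
    then have "(2::nat) ^ L = 2 * 2 ^ (L - Suc j) * 2 ^ j" "(2::nat) ^ (L - j) = 2 * 2 ^ (L - Suc j)"
      by (metis power_Suc power_add)+
    then show ?thesis
      by (simp add: R_def card_cartesian_product)
  qed
  have "R i \<inter> R j = {}" if "i < j" "j < L" for i j
  proof -
    have "(2::nat) ^ (L - j) \<le> 2 ^ (L - Suc i)"
      using that by (intro power_increasing) auto
    moreover have "fst w < 2 ^ (L - j) \<and> 2 ^ (L - Suc i) \<le> fst w" if "w \<in> R i \<inter> R j" for w
      using that by (auto simp: R_def)
    ultimately show ?thesis by (metis disjoint_iff IntI leD order_less_le_trans)
  qed
  then have "disjoint_family_on R {..<L}"
    unfolding disjoint_family_on_def by (metis Int_commute lessThan_iff linorder_neqE_nat)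
  then have "card (\<Union>j<L. R j) = (\<Sum>j<L. card (R j))"
    by (intro card_UN_disjoint) (simp_all add: disjoint_family_on_def, simp add: R_def)
  then have "2 * card (\<Union>j<L. R j) = (\<Sum>j<L. 2 ^ L)"
    by (simp add: sum_distrib_left card_R)
  moreover have "card (\<Union>j<L. R j) \<le> card (staircase L)"
  proof (rule card_mono)
    show "finite (staircase L)"
      using staircase_subset finite_subset finite_level_indices by blast
    show "(\<Union>j<L. R j) \<subseteq> staircase L"
    proof
      fix w assume "w \<in> (\<Union>j<L. R j)"
      then obtain j u v where j: "j < L" "w = (u, v)" "u < 2 ^ (L - j)" "v < 2 ^ j"
        by (auto simp: R_def)
      moreover have "u < 2 ^ L"
        by (rule less_le_trans[OF j(3)]) simp
      moreover have "v < 2 ^ L"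
        by (rule less_le_trans[OF j(4)]) (use j in simp)
      ultimately show "w \<in> staircase L"
        by (auto simp: staircase_def level_indices_def)
    qed
  qed
  ultimately show ?thesis by simp
qed

text \<open>
  The digit groups of different blocks are independent, so the fractions left over by the staircases
  multiply. The induction carries along the representation of the remaining set by index pairs.
\<close>
lemma measure_avoiding_staircases:
  "measure lborel {x \<in> unit_square. \<forall>i<n. x \<notin> block_set (k + i * L) L (staircase L)}
     \<le> (1 - L / 2 ^ Suc L) ^ n"
proof -
  define D where "D = level_indices L - staircase L"
  have D: "D \<subseteq> level_indices L" by (auto simp: D_def)
  have "x \<in> block_set a L D \<longleftrightarrow> x \<in> unit_square \<and> x \<notin> block_set a L (staircase L)" for a x
    by (auto simp: block_set_def level_set_def D_def last_digits_def level_indices_def)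
  \<comment> \<open>Avoiding one more staircase imposes a condition on the next digit group only.\<close>
  then have avoid: "{x \<in> unit_square. \<forall>i<Suc n. x \<notin> block_set (k + i * L) L (staircase L)} =
      {x \<in> unit_square. \<forall>i<n. x \<notin> block_set (k + i * L) L (staircase L)} \<inter> block_set (k + n * L) L D" for n
    by (auto simp: less_Suc_eq)
  have "\<exists>W\<subseteq>level_indices (k + n * L).
      {x \<in> unit_square. \<forall>i<n. x \<notin> block_set (k + i * L) L (staircase L)} = level_set (k + n * L) W \<and>
      card W = 4 ^ k * card D ^ n"
  proof (induction n)
    case 0
    show ?case
      by (intro exI[of _ "level_indices k"]) (simp add: level_set_all card_level_indices)
  next
    case (Suc n)
    then obtain W where W: "W \<subseteq> level_indices (k + n * L)"
      "{x \<in> unit_square. \<forall>i<n. x \<notin> block_set (k + i * L) L (staircase L)} = level_set (k + n * L) W"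
      "card W = 4 ^ k * card D ^ n" by blast
    show ?case
      using card_refined_indices[OF W(1) D] W
      by (intro exI[of _ "{w. drop_digits L w \<in> W \<and> last_digits L w \<in> D}"] conjI)
        (simp_all only: avoid level_set_Int_block_set, simp_all add: ac_simps)
  qed
  then obtain W where W: "W \<subseteq> level_indices (k + n * L)"
    "{x \<in> unit_square. \<forall>i<n. x \<notin> block_set (k + i * L) L (staircase L)} = level_set (k + n * L) W"
    "card W = 4 ^ k * card D ^ n" by blast
  have "measure lborel {x \<in> unit_square. \<forall>i<n. x \<notin> block_set (k + i * L) L (staircase L)} =
      (card D / 4 ^ L) ^ n"
    unfolding W(2) measure_level_set[OF W(1)] W(3)
    by (simp add: power_add power_mult power_divide mult.commute[of n])
  also have "\<dots> \<le> (1 - L / 2 ^ Suc L) ^ n"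
  proof (rule power_mono)
    have "card D = 4 ^ L - card (staircase L)"
      using finite_subset[OF staircase_subset finite_level_indices, of L] staircase_subset
      by (simp add: D_def card_Diff_subset card_level_indices)
    moreover have "card (staircase L) \<le> 4 ^ L"
      using card_mono[OF finite_level_indices staircase_subset] by (simp add: card_level_indices)
    ultimately have "real (card D) = 4 ^ L - real (card (staircase L))"
      by (simp add: of_nat_diff)
    moreover have "real L * 2 ^ L \<le> 2 * real (card (staircase L))"
      using card_staircase_ge[of L, THEN of_nat_mono[where 'a = real]] by simp
    moreover have "(4::real) ^ L = 2 ^ L * 2 ^ L"
      by (simp add: power_mult_distrib[symmetric])
    ultimately show "card D / 4 ^ L \<le> 1 - L / 2 ^ Suc L"
      by (simp add: field_simps)
  qed simp
  finally show ?thesis .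
qed

text \<open>
  If the point lies in the staircase by virtue of \<open>j\<close>, then its cell in the grid with \<open>a + j\<close> and
  \<open>a + (L - j)\<close> halvings is one of the boxes at the corner and contains the whole square in which all
  digits of the block vanish. The square has the fraction \<open>2^-L\<close> of the area of the cell.
\<close>
lemma cell_average_block_corner:
  assumes x: "x \<in> block_set a L (staircase L)"
  shows "\<exists>j\<le>L. 1 / 2 ^ L \<le>
    cell_average (dyadic_grid (a + j) (a + (L - j))) (indicator (block_set a L {(0, 0)})) x"
proof -
  define P Q where "P = dyadic_index (a + L) (x $ 1)" and "Q = dyadic_index (a + L) (x $ 2)"
  have xU: "x \<in> unit_square" using x by (simp add: block_set_def level_set_def)
  obtain j where j: "j < L" "P mod 2 ^ L < 2 ^ (L - j)" "Q mod 2 ^ L < 2 ^ j"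
    using x by (auto simp: block_set_def level_set_def staircase_def last_digits_def P_def Q_def)
  define p q where "p = dyadic_index (a + j) (x $ 1)" and "q = dyadic_index (a + (L - j)) (x $ 2)"
  have pq: "p = P div 2 ^ (L - j)" "q = Q div 2 ^ j"
    using dyadic_index_div[of "x $ 1" "a + j" "L - j"] dyadic_index_div[of "x $ 2" "a + (L - j)" j] j xU
    by (simp_all add: p_def q_def P_def Q_def mem_unit_square)
  have zeros: "p mod 2 ^ j = 0" "q mod 2 ^ (L - j) = 0"
  proof -
    have "P mod 2 ^ L div 2 ^ (L - j) = 0" "Q mod 2 ^ L div 2 ^ j = 0"
      using j by auto
    then show "p mod 2 ^ j = 0" "q mod 2 ^ (L - j) = 0"
      unfolding pq using j by (simp_all add: div_exp_mod_exp_eq)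
  qed
  define B where "B = cell (dyadic_grid (a + j) (a + (L - j))) x"
  have B: "B = dyadic_box (a + j) (a + (L - j)) p q"
    unfolding B_def p_def q_def by (rule cell_dyadic_grid[OF xU])
  have pq_less: "p < 2 ^ (a + j)" "q < 2 ^ (a + (L - j))"
    unfolding p_def q_def by (intro dyadic_index_unit_square xU)+
  have sum_levels: "(a + j) + (a + (L - j)) = 2 * a + L" using j by simp
  have measB: "measure lborel B = 1 / 2 ^ (2 * a + L)"
    unfolding B measure_dyadic_box[OF pq_less] sum_levels ..
  \<comment> \<open>The square at the lower left corner of the cell.\<close>
  define C where "C = dyadic_box (a + L) (a + L) (p * 2 ^ (L - j)) (q * 2 ^ j)"
  have C_sub: "C \<subseteq> B \<inter> block_set a L {(0, 0)}"
  proof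
    fix y assume "y \<in> C"
    then have y: "y \<in> unit_square" "dyadic_index (a + L) (y $ 1) = p * 2 ^ (L - j)"
        "dyadic_index (a + L) (y $ 2) = q * 2 ^ j"
      by (auto simp: C_def mem_dyadic_box_iff)
    then have "dyadic_index (a + j) (y $ 1) = p" "dyadic_index (a + (L - j)) (y $ 2) = q"
      using dyadic_index_div[of "y $ 1" "a + j" "L - j"] dyadic_index_div[of "y $ 2" "a + (L - j)" j] j
      by (simp_all add: mem_unit_square)
    moreover have "(p * 2 ^ (L - j)) mod 2 ^ L = 0" "(q * 2 ^ j) mod 2 ^ L = 0"
    proof -
      have "(2::nat) ^ L = 2 ^ j * 2 ^ (L - j)"
        using j by (simp add: power_add[symmetric])
      moreover have "2 ^ j dvd p" "2 ^ (L - j) dvd q" using zeros by auto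
      ultimately show "(p * 2 ^ (L - j)) mod 2 ^ L = 0" "(q * 2 ^ j) mod 2 ^ L = 0"
        by (simp_all add: mult.commute mult_dvd_mono mod_eq_0_iff_dvd)
    qed
    ultimately show "y \<in> B \<inter> block_set a L {(0, 0)}"
      using y by (auto simp: B mem_dyadic_box_iff block_set_def level_set_def last_digits_def)
  qed
  have "p * 2 ^ (L - j) < 2 ^ (a + j) * 2 ^ (L - j)" "q * 2 ^ j < 2 ^ (a + (L - j)) * 2 ^ j"
    using pq_less by auto
  then have "p * 2 ^ (L - j) < 2 ^ (a + L)" "q * 2 ^ j < 2 ^ (a + L)"
    using j by (simp_all add: power_add[symmetric])
  then have measC: "measure lborel C = 1 / 2 ^ ((a + L) + (a + L))"
    unfolding C_def by (rule measure_dyadic_box)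
  have [measurable, simp]: "B \<in> sets borel" "C \<in> sets borel"
    unfolding B C_def by (simp_all add: dyadic_box_borel)
  have finB: "emeasure lborel (B \<inter> block_set a L {(0, 0)}) < \<infinity>"
  proof -
    have "emeasure lborel (B \<inter> block_set a L {(0, 0)}) \<le> emeasure lborel B"
      by (intro emeasure_mono) auto
    also have "\<dots> < \<infinity>"
      unfolding B emeasure_dyadic_box[OF pq_less] by simp
    finally show ?thesis .
  qed
  have "measure lborel C \<le> measure lborel (B \<inter> block_set a L {(0, 0)})"
    using C_sub finB by (intro measure_mono_fmeasurable) (auto simp: fmeasurable_def)
  also have "\<dots> = (LINT u:B|lborel. indicat_real (block_set a L {(0, 0)}) u)"
  proof -
    have "(LINT u:B|lborel. indicat_real (block_set a L {(0, 0)}) u) =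
        (LINT u|lborel. indicat_real (B \<inter> block_set a L {(0, 0)}) u)"
      unfolding set_lebesgue_integral_def
      by (intro Bochner_Integration.integral_cong) (auto simp: indicator_def)
    then show ?thesis by simp
  qed
  finally have "2 ^ (2 * a + L) * (1 / 2 ^ ((a + L) + (a + L))) \<le>
      2 ^ (2 * a + L) * (LINT u:B|lborel. indicat_real (block_set a L {(0, 0)}) u)"
    unfolding measC by (intro mult_left_mono) auto
  moreover have "2 ^ (2 * a + L) * (1 / 2 ^ ((a + L) + (a + L))) = 1 / (2 ^ L :: real)"
    by (simp add: power_add mult_2)
  ultimately have "1 / 2 ^ L \<le>
      cell_average (dyadic_grid (a + j) (a + (L - j))) (indicat_real (block_set a L {(0, 0)})) x"
    unfolding cell_average_def B_def[symmetric] measB by simp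
  then show ?thesis using j by (intro exI[of _ j]) auto
qed

text \<open>
  The integral is proportional to \<open>n * 2^-L\<close>, while the exponent of the missed area is proportional to
  \<open>n * L * 2^-L\<close>. Fixing the latter at a large value \<open>m\<close> makes the former of order \<open>m / L\<close>, which is
  small for large \<open>L\<close>.
\<close>
lemma spike_parameters:
  fixes K e :: real
  assumes "K > 0" "e > 0"
  obtains L n :: nat where "n * (K / 2 ^ L) \<le> e" "(1 - L / 2 ^ Suc L) ^ n \<le> e"
proof -
  define m where "m = max 1 (- ln e)"
  have m: "m \<ge> 1" "exp (- m) \<le> e"
  proof -
    show "m \<ge> 1" by (simp add: m_def)
    have "exp (- m) \<le> exp (ln e)"
      unfolding exp_le_cancel_iff by (simp add: m_def)
    then show "exp (- m) \<le> e" using \<open>e > 0\<close> by simp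
  qed
  \<comment> \<open>With \<open>n \<le> m * 2^(L+1) / L + 1\<close> the integral is at most \<open>K * (2 * m + 1) / L\<close>.\<close>
  obtain L where L: "K * (2 * m + 1) / e < real L"
    using reals_Archimedean2 by blast
  have L0: "0 < real L"
    using L assms m by (smt (verit) divide_pos_pos mult_pos_pos)
  define n where "n = nat \<lceil>m * 2 ^ Suc L / L\<rceil>"
  have n: "m * 2 ^ Suc L / L \<le> n" "n \<le> m * 2 ^ Suc L / L + 1"
    using L0 m by (simp_all add: n_def)
  have "n * (K / 2 ^ L) \<le> (m * 2 ^ Suc L / L + 1) * (K / 2 ^ L)"
    using n assms by (intro mult_right_mono) auto
  also have "\<dots> = 2 * m * K / L + K / 2 ^ L"
    using L0 by (simp add: field_simps)
  also have "K / 2 ^ L \<le> K / L"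
    using assms L0 of_nat_less_two_power[of L, where 'a = real] by (intro divide_left_mono) auto
  also have "2 * m * K / L + K / L = K * (2 * m + 1) / L"
    using L0 by (simp add: field_simps)
  also have "\<dots> \<le> e"
    using L L0 assms by (simp add: field_simps)
  finally have 1: "n * (K / 2 ^ L) \<le> e" by simp
  have "real L \<le> 2 ^ Suc L"
    unfolding power_Suc using of_nat_less_two_power[of L, where 'a = real] L0 by linarith
  then have "(1 - L / 2 ^ Suc L) ^ n \<le> exp (- (L / 2 ^ Suc L)) ^ n"
    using exp_ge_add_one_self[of "- (L / 2 ^ Suc L)"] by (intro power_mono) auto
  also have "\<dots> = exp (- (n * (L / 2 ^ Suc L)))"
    by (simp add: exp_of_nat_mult[symmetric])
  also have "\<dots> \<le> exp (- m)"
    using n(1) L0 by (simp add: field_simps)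
  finally have 2: "(1 - L / 2 ^ Suc L) ^ n \<le> e" using m by simp
  show thesis using that[OF 1 2] .
qed

text \<open>
  The blocks start after the first \<open>k\<close> digits, so that only grids with mesh at most of order \<open>2^-k\<close> are
  used. The bound \<open>A\<close> makes these grids finite in number, which allows all of them, for all \<open>k\<close>, to be
  listed in one sequence whose mesh tends to zero.
\<close>
lemma spike_function_exists:
  fixes K e :: real and k :: nat
  assumes "K > 0" "e > 0"
  shows "\<exists>g A V. integrable lborel g \<and> (\<forall>x. 0 \<le> g x) \<and> (LINT x|lborel. g x) \<le> e \<and>
    V \<in> sets lborel \<and> V \<subseteq> unit_square \<and> measure lborel V \<le> e \<and>
    (\<forall>x\<in>unit_square - V. \<exists>a\<in>{k..A}. \<exists>b\<in>{k..A}. K \<le> cell_average (dyadic_grid a b) g x)"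
proof -
  obtain L n where mass: "n * (K / 2 ^ L) \<le> e" and miss: "(1 - L / 2 ^ Suc L) ^ n \<le> e"
    using spike_parameters[OF assms] .
  define S where "S i = block_set (k + i * L) L {(0, 0)}" for i
  define g where "g x = (\<Sum>i<n. K * 2 ^ L * indicator (S i) x)" for x
  define V where "V = {x \<in> unit_square. \<forall>i<n. x \<notin> block_set (k + i * L) L (staircase L)}"
  have [measurable]: "S i \<in> sets lborel" for i by (simp add: S_def)
  have finS: "emeasure lborel (S i) < \<infinity>" for i
  proof -
    have "emeasure lborel (S i) \<le> emeasure lborel unit_square"
      by (intro emeasure_mono) (auto simp: S_def block_set_def level_set_def)
    then show ?thesis by (simp add: order_le_less_trans)
  qed
  have intS: "integrable lborel (\<lambda>x. K * 2 ^ L * indicator (S i) x)" for i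
    by (intro integrable_mult_right integrable_real_indicator finS) measurable
  have intg: "integrable lborel g"
    unfolding g_def by (intro Bochner_Integration.integrable_sum intS)
  have "(LINT x|lborel. g x) = (\<Sum>i<n. LINT x|lborel. K * 2 ^ L * indicator (S i) x)"
    unfolding g_def by (rule Bochner_Integration.integral_sum) (rule intS)
  also have "\<dots> = (\<Sum>i<n. K * 2 ^ L * measure lborel (S i))"
    by simp
  also have "\<dots> = (\<Sum>i<n. K / 2 ^ L)"
  proof (rule sum.cong)
    fix i
    have "measure lborel (S i) = 1 / 4 ^ L"
      unfolding S_def by (subst measure_block_set) (auto simp: level_indices_def)
    moreover have "(4::real) ^ L = 2 ^ L * 2 ^ L"
      by (simp add: power_mult_distrib[symmetric])
    ultimately show "K * 2 ^ L * measure lborel (S i) = K / 2 ^ L" by simp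
  qed simp
  also have "\<dots> \<le> e" using mass by simp
  finally have int_le: "(LINT x|lborel. g x) \<le> e" .
  have g0: "0 \<le> g x" for x
    using assms by (auto simp: g_def intro!: sum_nonneg)
  have large: "\<exists>a\<in>{k..k + n * L + L}. \<exists>b\<in>{k..k + n * L + L}. K \<le> cell_average (dyadic_grid a b) g x"
    if x: "x \<in> unit_square - V" for x
  proof -
    obtain i where i: "i < n" "x \<in> block_set (k + i * L) L (staircase L)"
      using x by (auto simp: V_def)
    obtain j where j: "j \<le> L" and avg: "1 / 2 ^ L \<le>
        cell_average (dyadic_grid (k + i * L + j) (k + i * L + (L - j))) (indicator (S i)) x"
      using cell_average_block_corner[OF i(2)] unfolding S_def by blast
    have "K = K * 2 ^ L * (1 / 2 ^ L)" by simp
    also have "\<dots> \<le> K * 2 ^ L * cell_average (dyadic_grid (k + i * L + j) (k + i * L + (L - j))) (indicator (S i)) x"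
      using assms avg by (intro mult_left_mono) auto
    also have "\<dots> = cell_average (dyadic_grid (k + i * L + j) (k + i * L + (L - j)))
        (\<lambda>x. K * 2 ^ L * indicator (S i) x) x"
      by (simp add: cell_average_def set_integral_mult_right)
    also have "\<dots> \<le> cell_average (dyadic_grid (k + i * L + j) (k + i * L + (L - j))) g x"
    proof (rule cell_average_mono)
      show "AE u in lborel. K * 2 ^ L * indicator (S i) u \<le> g u"
        unfolding g_def
        by (intro AE_I2 member_le_sum[where f = "\<lambda>i. K * 2 ^ L * indicator (S i) u" for u])
          (use assms i in auto)
    qed (use x intS intg in auto)
    finally have "K \<le> cell_average (dyadic_grid (k + i * L + j) (k + i * L + (L - j))) g x" .
    moreover have "i * L \<le> n * L" by (rule mult_right_mono) (use i in auto)
    then have "k + i * L + j \<in> {k..k + n * L + L}" "k + i * L + (L - j) \<in> {k..k + n * L + L}"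
      unfolding atLeastAtMost_iff using j by linarith+
    ultimately show ?thesis by blast
  qed
  have "V \<in> sets borel"
  proof -
    have "V = {x \<in> space borel. x \<in> unit_square \<and> (\<forall>i\<in>{..<n}. x \<notin> block_set (k + i * L) L (staircase L))}"
      by (auto simp: V_def)
    also have "\<dots> \<in> sets borel" by measurable
    finally show ?thesis .
  qed
  moreover have "measure lborel V \<le> e"
    using measure_avoiding_staircases[of n k L] miss unfolding V_def by linarith
  ultimately show ?thesis
    using intg g0 int_le large
    by (intro exI[of _ g] exI[of _ "k + n * L + L"] exI[of _ V]) (auto simp: V_def)
qed

section \<open>An integrable function with unbounded cell averages\<close>

text \<open>
  The averages of the sum dominate those of every summand because all summands are nonnegative, so
  different spikes cannot cancel each other. The integrals and the exceptional areas of the summands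
  are both summable.
\<close>
lemma oscillating_function_exists:
  obtains h :: "real ^ 2 \<Rightarrow> real" and A :: "nat \<Rightarrow> nat"
  where "h \<in> borel_measurable borel" "\<And>x. 0 \<le> h x" "integrable lborel h"
    "AE x in lborel. x \<in> unit_square \<longrightarrow>
       (\<forall>c. \<exists>k. \<exists>a\<in>{k..A k}. \<exists>b\<in>{k..A k}. c \<le> cell_average (dyadic_grid a b) h x)"
proof -
  define spike where "spike k g A V \<longleftrightarrow> integrable lborel g \<and> (\<forall>x. 0 \<le> g x) \<and>
    (LINT x|lborel. g x) \<le> (1/2) ^ k \<and>
    V \<in> sets lborel \<and> V \<subseteq> unit_square \<and> measure lborel V \<le> (1/2) ^ k \<and>
    (\<forall>x\<in>unit_square - V. \<exists>a\<in>{k..A}. \<exists>b\<in>{k..A}. real (Suc k) \<le> cell_average (dyadic_grid a b) g x)"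
    for k g A V
  have "\<exists>g A V. spike k g A V" for k
    unfolding spike_def by (rule spike_function_exists) auto
  then obtain g A V where spike: "\<And>k. spike k (g k) (A k) (V k)" by metis
  have g [simp]: "integrable lborel (g k)" "0 \<le> g k x" and g_le: "(LINT x|lborel. g k x) \<le> (1/2) ^ k"
    and V [measurable]: "V k \<in> sets lborel" and V_sub: "V k \<subseteq> unit_square"
    and V_le: "measure lborel (V k) \<le> (1/2) ^ k" for k x
    using spike[of k] unfolding spike_def by simp_all
  have large: "\<exists>a\<in>{k..A k}. \<exists>b\<in>{k..A k}. real (Suc k) \<le> cell_average (dyadic_grid a b) (g k) x"
    if "x \<in> unit_square - V k" for k x
    using spike[of k] that unfolding spike_def by blast
  have [measurable]: "g k \<in> borel_measurable borel" for k
    using borel_measurable_integrable[OF g(1)] by simp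
  define G where "G x = (\<Sum>k. ennreal (g k x))" for x
  \<comment> \<open>On the null set where the series diverges, \<open>enn2real\<close> returns \<open>0\<close>.\<close>
  define h where "h x = enn2real (G x)" for x
  have [measurable]: "G \<in> borel_measurable borel" "h \<in> borel_measurable borel"
    unfolding G_def h_def by measurable
  have "(\<integral>\<^sup>+x. G x \<partial>lborel) = (\<Sum>k. \<integral>\<^sup>+x. ennreal (g k x) \<partial>lborel)"
    unfolding G_def by (rule nn_integral_suminf) simp
  also have "\<dots> \<le> (\<Sum>k. ennreal ((1/2) ^ k))"
    using g_le by (intro suminf_le) (auto simp: nn_integral_eq_integral)
  also have "\<dots> < \<infinity>"
    by (subst suminf_ennreal2) (auto intro: summable_geometric)
  finally have G_fin: "(\<integral>\<^sup>+x. G x \<partial>lborel) < \<infinity>" .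
  have AE_fin: "AE x in lborel. G x \<noteq> \<infinity>"
    using G_fin by (intro nn_integral_PInf_AE) auto
  have int_h: "integrable lborel h"
  proof (rule integrableI_bounded)
    have "(\<integral>\<^sup>+x. ennreal (norm (h x)) \<partial>lborel) \<le> (\<integral>\<^sup>+x. G x \<partial>lborel)"
    proof (rule nn_integral_mono_AE)
      show "AE x in lborel. ennreal (norm (h x)) \<le> G x"
        using AE_fin by eventually_elim (simp add: h_def less_top)
    qed
    then show "(\<integral>\<^sup>+x. ennreal (norm (h x)) \<partial>lborel) < \<infinity>"
      using G_fin by (rule order_le_less_trans)
  qed simp
  have h_nonneg: "0 \<le> h x" for x
    by (simp add: h_def)
  have g_le_h: "AE x in lborel. g k x \<le> h x" for k
    using AE_fin
  proof eventually_elim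
    case (elim x)
    have "ennreal (g k x) = (\<Sum>i\<in>{k}. ennreal (g i x))"
      by simp
    also have "\<dots> \<le> G x"
      unfolding G_def by (rule sum_le_suminf[OF summableI]) (rule finite.intros zero_le)+
    also have "\<dots> = ennreal (h x)"
      using elim by (simp add: h_def less_top)
    finally show ?case
      using ennreal_le_iff[of "h x" "g k x"] h_nonneg by blast
  qed
  have "summable (\<lambda>k. measure lborel (V k))"
    by (rule summable_comparison_test[of _ "\<lambda>k. (1/2) ^ k"]) (auto simp: V_le summable_geometric)
  moreover have "emeasure lborel (V k) < \<infinity>" for k
  proof -
    have "emeasure lborel (V k) \<le> emeasure lborel unit_square"
      by (intro emeasure_mono V_sub) simp
    then show ?thesis by (simp add: order_le_less_trans)
  qed
  ultimately have "AE x in lborel. \<forall>\<^sub>F k in sequentially. x \<in> space lborel - V k"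
    by (intro borel_cantelli_AE1 V)
  then have osc: "AE x in lborel. x \<in> unit_square \<longrightarrow>
       (\<forall>c. \<exists>k. \<exists>a\<in>{k..A k}. \<exists>b\<in>{k..A k}. c \<le> cell_average (dyadic_grid a b) h x)"
  proof eventually_elim
    case (elim x)
    show ?case
    proof (intro impI allI)
      fix c :: real assume x: "x \<in> unit_square"
      obtain k0 where k0: "c \<le> real k0"
        using real_arch_simple by blast
      obtain k1 where k1: "\<forall>k\<ge>k1. x \<notin> V k"
        using elim unfolding eventually_sequentially by blast
      define k where "k = max k0 k1"
      have k: "x \<notin> V k" "c \<le> real k"
        using k0 k1 by (simp_all add: k_def)
      have "x \<in> unit_square - V k"
        using x k(1) by simp
      from large[OF this] obtain a where a: "a \<in> {k..A k}"
        "\<exists>b\<in>{k..A k}. real (Suc k) \<le> cell_average (dyadic_grid a b) (g k) x"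
        by (rule bexE)
      from a(2) obtain b where b: "b \<in> {k..A k}"
        "real (Suc k) \<le> cell_average (dyadic_grid a b) (g k) x"
        by (rule bexE)
      have "cell_average (dyadic_grid a b) (g k) x \<le> cell_average (dyadic_grid a b) h x"
        by (rule cell_average_mono[of x "g k" h, OF x g(1) int_h g_le_h])
      then have "c \<le> cell_average (dyadic_grid a b) h x"
        using b(2) k(2) by linarith
      then show "\<exists>k. \<exists>a\<in>{k..A k}. \<exists>b\<in>{k..A k}. c \<le> cell_average (dyadic_grid a b) h x"
        using a(1) b(1) by (intro exI[of _ k] bexI[of _ a] bexI[of _ b])
    qed
  qed
  show thesis
    by (rule that[OF _ _ int_h osc]) (simp_all add: h_def[abs_def])
qed

text \<open>
  Each index range contributes finitely many pairs, and a pair with a small component can only come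
  from one of finitely many ranges. Hence in any enumeration without repetition both components tend
  to infinity. Enlarging the ranges to be nonempty makes the set of pairs infinite.
\<close>
lemma level_enumeration_exists:
  fixes A :: "nat \<Rightarrow> nat"
  obtains \<alpha> \<beta> :: "nat \<Rightarrow> nat"
  where "filterlim \<alpha> at_top sequentially" "filterlim \<beta> at_top sequentially"
    "\<And>k a b. a \<in> {k..A k} \<Longrightarrow> b \<in> {k..A k} \<Longrightarrow> \<exists>j. \<alpha> j = a \<and> \<beta> j = b"
proof -
  define W where "W = (\<Union>k. {k..max k (A k)} \<times> {k..max k (A k)})"
  define w where "w = from_nat_into W"
  have "infinite W"
  proof
    assume "finite W"
    moreover have "range (\<lambda>k::nat. (k, k)) \<subseteq> W" by (force simp: W_def)
    ultimately have "finite (range (\<lambda>k::nat. (k, k)))" by (rule rev_finite_subset)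
    then show False by (simp add: finite_image_iff inj_def)
  qed
  then have w: "bij_betw w UNIV W"
    unfolding w_def by (intro bij_betw_from_nat_into) auto
  have finite_low: "finite {p \<in> W. fst p < m \<or> snd p < m}" for m
  proof (rule finite_subset)
    show "{p \<in> W. fst p < m \<or> snd p < m} \<subseteq> (\<Union>k<m. {k..max k (A k)} \<times> {k..max k (A k)})"
      by (force simp: W_def)
  qed auto
  have ev: "\<forall>\<^sub>F j in sequentially. m \<le> fst (w j) \<and> m \<le> snd (w j)" for m
  proof -
    have "{j. \<not> (m \<le> fst (w j) \<and> m \<le> snd (w j))} = w -` {p \<in> W. fst p < m \<or> snd p < m}"
      using w by (auto simp: bij_betw_def)
    also have "finite \<dots>"
      using w by (intro finite_vimageI finite_low) (auto simp: bij_betw_def)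
    finally show ?thesis
      by (simp add: cofinite_eq_sequentially[symmetric] eventually_cofinite)
  qed
  show thesis
  proof (rule that[of "fst \<circ> w" "snd \<circ> w"])
    show "filterlim (fst \<circ> w) at_top sequentially"
      unfolding filterlim_at_top comp_def
    proof
      show "\<forall>\<^sub>F j in sequentially. Z \<le> fst (w j)" for Z
        using ev[of Z] by (rule eventually_mono) simp
    qed
    show "filterlim (snd \<circ> w) at_top sequentially"
      unfolding filterlim_at_top comp_def
    proof
      show "\<forall>\<^sub>F j in sequentially. Z \<le> snd (w j)" for Z
        using ev[of Z] by (rule eventually_mono) simp
    qed
    fix k a b assume "a \<in> {k..A k}" "b \<in> {k..A k}"
    then have "(a, b) \<in> W" by (force simp: W_def)
    then obtain j where "w j = (a, b)" using w by (force simp: bij_betw_def)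
    then show "\<exists>j. (fst \<circ> w) j = a \<and> (snd \<circ> w) j = b" by (intro exI[of _ j]) simp
  qed
qed

section \<open>Changing the partition slowly\<close>

text \<open>
  If each of countably many error sequences tends to zero almost surely, then so does the error of a
  procedure that switches slowly from one sequence to the next: the \<open>j\<close>-th sequence is used only from
  a time on after which it exceeds \<open>(1/2)^j\<close> with probability at most \<open>(1/2)^j\<close>. The times \<open>s j\<close> of first
  use are provided because the limit along them recovers every member of the family.
\<close>
lemma (in prob_space) slow_schedule_exists:
  fixes e :: "nat \<Rightarrow> nat \<Rightarrow> 'a \<Rightarrow> real"
  assumes [measurable]: "\<And>j N. e j N \<in> borel_measurable M"
    and lim: "\<And>j. AE \<omega> in M. (\<lambda>N. e j N \<omega>) \<longlonglongrightarrow> 0"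
  obtains s \<kappa> :: "nat \<Rightarrow> nat"
  where "strict_mono s" "\<And>j. \<kappa> (s j) = j" "filterlim \<kappa> at_top sequentially"
    "AE \<omega> in M. (\<lambda>N. e (\<kappa> N) N \<omega>) \<longlonglongrightarrow> 0"
proof -
  define A where "A j n = {\<omega>\<in>space M. \<exists>N\<ge>n. \<bar>e j N \<omega>\<bar> > (1/2) ^ j}" for j n
  have [measurable]: "A j n \<in> sets M" for j n
    unfolding A_def by measurable
  have A_antimono: "A j n \<subseteq> A j m" if "m \<le> n" for j m n
    using that by (auto simp: A_def intro: order_trans)
  have "\<exists>n. prob (A j n) < (1/2) ^ j" for j
  proof -
    have "(\<lambda>n. prob (A j n)) \<longlonglongrightarrow> prob (\<Inter>n. A j n)"
      by (rule finite_Lim_measure_decseq) (auto simp: decseq_def A_antimono)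
    moreover have "prob (\<Inter>n. A j n) = 0"
    proof -
      have "AE \<omega> in M. \<omega> \<notin> (\<Inter>n. A j n)"
        using lim[of j]
      proof eventually_elim
        case (elim \<omega>)
        then have "\<forall>\<^sub>F N in sequentially. dist (e j N \<omega>) 0 < (1/2) ^ j"
          by (rule tendstoD) simp
        then obtain n where "\<forall>N\<ge>n. \<bar>e j N \<omega>\<bar> < (1/2) ^ j"
          by (auto simp: eventually_sequentially)
        then have "\<omega> \<notin> A j n"
          by (auto simp: A_def dest: less_asym)
        then show ?case by blast
      qed
      then show ?thesis
        by (simp add: prob_eq_0)
    qed
    ultimately have "\<forall>\<^sub>F n in sequentially. prob (A j n) < (1/2) ^ j"
      by (intro order_tendstoD(2)[where y = 0]) auto
    then show ?thesis by (auto simp: eventually_sequentially)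
  qed
  then obtain n where n: "\<And>j. prob (A j (n j)) < (1/2) ^ j" by metis
  \<comment> \<open>\<open>s\<close> is a strictly increasing sequence above \<open>n\<close>, and \<open>\<kappa> N\<close> is the last \<open>j\<close> with \<open>s j \<le> N\<close>.\<close>
  define s where "s = rec_nat (n 0) (\<lambda>j m. max (Suc m) (n (Suc j)))"
  have s_Suc: "s (Suc j) = max (Suc (s j)) (n (Suc j))" for j by (simp add: s_def)
  have s: "strict_mono s"
    by (rule strict_monoI_Suc) (simp add: s_Suc)
  have n_le_s: "n j \<le> s j" for j
    by (cases j) (simp_all add: s_Suc, simp add: s_def)
  define \<kappa> where "\<kappa> N = Max (insert 0 {j. s j \<le> N})" for N
  have fin: "finite {j. s j \<le> N}" for N
    by (rule finite_subset[of _ "{..N}"]) (use strict_mono_imp_increasing[OF s] order_trans in auto)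
  have \<kappa>_s: "\<kappa> (s j) = j" for j
    unfolding \<kappa>_def by (rule Max_eqI) (use fin s in \<open>auto simp: strict_mono_less_eq\<close>)
  have \<kappa>_ge: "j \<le> \<kappa> N" if "s j \<le> N" for j N
    unfolding \<kappa>_def by (rule Max_ge) (use fin that in auto)
  have s_\<kappa>: "s (\<kappa> N) \<le> N" if "s 0 \<le> N" for N
  proof -
    have "\<kappa> N \<in> insert 0 {j. s j \<le> N}"
      unfolding \<kappa>_def by (rule Max_in) (use fin in auto)
    then show ?thesis using that by auto
  qed
  have "filterlim \<kappa> at_top sequentially"
    unfolding filterlim_at_top eventually_sequentially using \<kappa>_ge by blast
  moreover have "AE \<omega> in M. (\<lambda>N. e (\<kappa> N) N \<omega>) \<longlonglongrightarrow> 0"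
  proof -
    have "summable (\<lambda>j. prob (A j (s j)))"
    proof (rule summable_comparison_test)
      have "prob (A j (s j)) \<le> prob (A j (n j))" for j
        by (intro finite_measure_mono A_antimono n_le_s) simp
      then have "prob (A j (s j)) \<le> (1/2) ^ j" for j
        using n[of j] less_imp_le order_trans by blast
      then show "\<exists>J. \<forall>j\<ge>J. norm (prob (A j (s j))) \<le> (1/2) ^ j" by simp
    qed (simp add: summable_geometric)
    then have "AE \<omega> in M. \<forall>\<^sub>F j in sequentially. \<omega> \<in> space M - A j (s j)"
      by (intro borel_cantelli_AE1) (auto simp: less_top[symmetric])
    then show ?thesis
    proof eventually_elim
      case (elim \<omega>)
      then obtain J where J: "\<And>j. j \<ge> J \<Longrightarrow> \<omega> \<in> space M - A j (s j)"
        by (auto simp: eventually_sequentially)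
      have "(\<lambda>N. (1/2 :: real) ^ \<kappa> N) \<longlonglongrightarrow> 0"
        using filterlim_compose[OF LIMSEQ_realpow_zero[of "1/2 :: real"] \<open>filterlim \<kappa> at_top sequentially\<close>]
        by simp
      moreover have "\<forall>\<^sub>F N in sequentially. norm (e (\<kappa> N) N \<omega>) \<le> (1/2) ^ \<kappa> N"
        using eventually_ge_at_top[of "max (s 0) (s J)"]
      proof eventually_elim
        case (elim N)
        then have "J \<le> \<kappa> N" "s (\<kappa> N) \<le> N" using \<kappa>_ge s_\<kappa> by auto
        then show ?case using J[of "\<kappa> N"] by (auto simp: A_def not_less)
      qed
      ultimately show ?case
        by (rule Lim_null_comparison[rotated])
    qed
  qed
  ultimately show thesis
    using that[of s \<kappa>] s \<kappa>_s by blast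
qed

section \<open>Uniform samples and their cell ratios\<close>

lemma iid_sequence_of_pairs:
  fixes X :: "nat \<Rightarrow> 'w \<Rightarrow> real ^ 2" and \<phi> :: "(real ^ 2) \<times> real \<Rightarrow> real"
  assumes "prob_space M" "iid_pairs M X Y" and [measurable]: "\<phi> \<in> borel_measurable borel"
  shows "iid_sequence M (\<lambda>n \<omega>. \<phi> (X n \<omega>, Y n \<omega>))"
proof -
  interpret prob_space M by fact
  have indep: "indep_vars (\<lambda>_. borel) (\<lambda>n \<omega>. (X n \<omega>, Y n \<omega>)) UNIV"
    and ident: "distr M borel (\<lambda>\<omega>. (X n \<omega>, Y n \<omega>)) = distr M borel (\<lambda>\<omega>. (X 0 \<omega>, Y 0 \<omega>))" for n
    using assms by (auto simp: iid_pairs_def)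
  have [measurable]: "(\<lambda>\<omega>. (X n \<omega>, Y n \<omega>)) \<in> borel_measurable M" for n
    using indep unfolding indep_vars_def by simp
  have distr_eq: "distr M borel (\<lambda>\<omega>. \<phi> (X n \<omega>, Y n \<omega>)) = distr (distr M borel (\<lambda>\<omega>. (X n \<omega>, Y n \<omega>))) borel \<phi>" for n
    by (subst distr_distr) (auto simp: comp_def)
  show ?thesis
  proof
    show "indep_vars (\<lambda>_. borel) (\<lambda>n \<omega>. \<phi> (X n \<omega>, Y n \<omega>)) UNIV"
      by (rule indep_vars_compose2[OF indep]) simp
    show "distr M borel (\<lambda>\<omega>. \<phi> (X n \<omega>, Y n \<omega>)) = distr M borel (\<lambda>\<omega>. \<phi> (X 0 \<omega>, Y 0 \<omega>))" for n
      unfolding distr_eq ident[of n] ..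
  qed
qed

lemma uniform_measure_unit_square:
  "uniform_measure lborel unit_square = density lborel (\<lambda>x. ennreal (indicat_real unit_square x))"
  by (simp add: uniform_measure_def ennreal_indicator divide_ennreal_def)

lemma
  fixes f :: "real ^ 2 \<Rightarrow> real"
  assumes "uniform_on_unit_square M X" and [measurable]: "f \<in> borel_measurable borel"
  shows integrable_uniform: "integrable M (\<lambda>\<omega>. f (X \<omega>)) \<longleftrightarrow> set_integrable lborel unit_square f"
    and integral_uniform: "(LINT \<omega>|M. f (X \<omega>)) = (LINT x:unit_square|lborel. f x)"
proof -
  have [measurable]: "X \<in> borel_measurable M"
    and distr: "distr M lborel X = uniform_measure lborel unit_square"
    using assms by (auto simp: uniform_on_unit_square_def)
  have "integrable M (\<lambda>\<omega>. f (X \<omega>)) \<longleftrightarrow> integrable (distr M lborel X) f"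
    by (subst integrable_distr_eq) auto
  also have "\<dots> \<longleftrightarrow> set_integrable lborel unit_square f"
    unfolding distr uniform_measure_unit_square set_integrable_def
    by (rule integrable_density) auto
  finally show "integrable M (\<lambda>\<omega>. f (X \<omega>)) \<longleftrightarrow> set_integrable lborel unit_square f" .
  have "(LINT \<omega>|M. f (X \<omega>)) = integral\<^sup>L (distr M lborel X) f"
    by (subst integral_distr) auto
  also have "\<dots> = (LINT x:unit_square|lborel. f x)"
    unfolding distr uniform_measure_unit_square set_lebesgue_integral_def
    by (rule integral_density) auto
  finally show "(LINT \<omega>|M. f (X \<omega>)) = (LINT x:unit_square|lborel. f x)" .
qed

lemma AE_uniform:
  assumes "uniform_on_unit_square M X" "AE x in lborel. x \<in> unit_square \<longrightarrow> P x"
  shows "AE \<omega> in M. P (X \<omega>)"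
proof (rule AE_distrD[where M' = lborel])
  show "X \<in> measurable M lborel"
    using assms by (simp add: uniform_on_unit_square_def)
  have "AE x in uniform_measure lborel unit_square. P x"
    using assms(2) by (subst AE_uniform_measure) auto
  moreover have "distr M lborel X = uniform_measure lborel unit_square"
    using assms(1) by (simp only: uniform_on_unit_square_def)
  ultimately show "AE x in distr M lborel X. P x"
    by (simp only:)
qed

text \<open>
  The empirical estimate as a function of the cell, and below the cell average likewise. For a fixed
  grid this leaves finitely many random variables, in which the point of evaluation does not occur.
\<close>
definition cell_ratio :: "(nat \<Rightarrow> 'w \<Rightarrow> real ^ 2) \<Rightarrow> (nat \<Rightarrow> 'w \<Rightarrow> real) \<Rightarrow> nat \<Rightarrow> 'w
    \<Rightarrow> (real ^ 2) set \<Rightarrow> real" where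
  "cell_ratio X Y N \<omega> B = (if F_hat X N \<omega> B > 0 then mu_hat X Y N \<omega> B / F_hat X N \<omega> B else 0)"

definition box_average :: "(real ^ 2 \<Rightarrow> real) \<Rightarrow> (real ^ 2) set \<Rightarrow> real" where
  "box_average h B = (1 / measure lborel B) * (LINT u:B|lborel. h u)"

lemma cell_ratio_measurable [measurable]:
  assumes [measurable]: "\<And>n. X n \<in> borel_measurable M" "\<And>n. Y n \<in> borel_measurable M" "B \<in> sets borel"
  shows "(\<lambda>\<omega>. cell_ratio X Y N \<omega> B) \<in> borel_measurable M"
  unfolding cell_ratio_def mu_hat_def F_hat_def by measurable

text \<open>
  Numerator and denominator obey the strong law, and the denominator has a positive limit.
\<close>
lemma cell_ratio_tendsto:
  fixes X :: "nat \<Rightarrow> 'w \<Rightarrow> real ^ 2" and h :: "real ^ 2 \<Rightarrow> real"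
  assumes M: "prob_space M" and iid: "iid_pairs M X (\<lambda>n \<omega>. h (X n \<omega>))"
    and unif: "uniform_on_unit_square M (X 0)"
    and h [measurable]: "h \<in> borel_measurable borel" "\<And>x. 0 \<le> h x" "integrable lborel h"
    and B [measurable]: "B \<in> sets borel" "B \<subseteq> unit_square" "emeasure lborel B > 0"
  shows "AE \<omega> in M. (\<lambda>N. cell_ratio X (\<lambda>n \<omega>. h (X n \<omega>)) N \<omega> B) \<longlonglongrightarrow> box_average h B"
proof -
  have B_fin: "emeasure lborel B < \<infinity>"
  proof -
    have "emeasure lborel B \<le> emeasure lborel unit_square"
      using B by (intro emeasure_mono) auto
    then show ?thesis by (simp add: order_le_less_trans)
  qed
  have B_pos: "measure lborel B > 0"
    using B(3) B_fin by (simp add: measure_def enn2real_positive_iff)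
  have law: "AE \<omega> in M. (\<lambda>N. (1 / real N) * (\<Sum>n=1..N. f (X n \<omega>) * indicator B (X n \<omega>)))
      \<longlonglongrightarrow> (LINT u:B|lborel. f u)"
    if f [measurable]: "f \<in> borel_measurable borel" "\<And>x. 0 \<le> f x" "set_integrable lborel B f" for f :: "real ^ 2 \<Rightarrow> real"
  proof -
    interpret iid: iid_sequence M "\<lambda>n \<omega>. f (X n \<omega>) * indicator B (X n \<omega>)"
    proof -
      have "(\<lambda>(x, y). f x * indicat_real B x) \<in> borel_measurable (borel :: ((real ^ 2) \<times> real) measure)"
        unfolding borel_prod[symmetric] by measurable
      then show "iid_sequence M (\<lambda>n \<omega>. f (X n \<omega>) * indicator B (X n \<omega>))"
        using iid_sequence_of_pairs[OF M iid, of "\<lambda>(x, y). f x * indicator B x"] by simp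
    qed
    have eq: "indicator unit_square x * (f x * indicator B x) = indicator B x * f x" for x
      using B(2) by (auto simp: indicator_def)
    have "integrable M (\<lambda>\<omega>. f (X 0 \<omega>) * indicator B (X 0 \<omega>))"
      using integrable_uniform[OF unif, of "\<lambda>x. f x * indicator B x"] f(3)
      by (simp add: set_integrable_def eq)
    moreover have "(LINT \<omega>|M. f (X 0 \<omega>) * indicator B (X 0 \<omega>)) = (LINT u:B|lborel. f u)"
      using integral_uniform[OF unif, of "\<lambda>x. f x * indicator B x"]
      by (simp add: set_lebesgue_integral_def eq)
    ultimately show ?thesis
      using iid.strong_law_of_large_numbers f(2) unfolding iid.sample_mean_def by simp
  qed
  have "set_integrable lborel B h"
    unfolding set_integrable_def by (intro integrable_mult_indicator h) simp
  then have "AE \<omega> in M. (\<lambda>N. mu_hat X (\<lambda>n \<omega>. h (X n \<omega>)) N \<omega> B) \<longlonglongrightarrow> (LINT u:B|lborel. h u)"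
    unfolding mu_hat_def by (intro law h)
  moreover have "set_integrable lborel B (\<lambda>_. 1 :: real)"
    using B_fin by (simp add: set_integrable_def)
  then have "AE \<omega> in M. (\<lambda>N. F_hat X N \<omega> B) \<longlonglongrightarrow> measure lborel B"
    using law[of "\<lambda>_. 1"] unfolding F_hat_def mult_1 by (simp add: set_lebesgue_integral_def)
  ultimately show ?thesis
  proof eventually_elim
    case (elim \<omega>)
    have "(\<lambda>N. mu_hat X (\<lambda>n \<omega>. h (X n \<omega>)) N \<omega> B / F_hat X N \<omega> B) \<longlonglongrightarrow> (LINT u:B|lborel. h u) / measure lborel B"
      using elim B_pos by (intro tendsto_divide) auto
    then have "(\<lambda>N. mu_hat X (\<lambda>n \<omega>. h (X n \<omega>)) N \<omega> B / F_hat X N \<omega> B) \<longlonglongrightarrow> box_average h B"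
      by (simp add: box_average_def)
    moreover have "\<forall>\<^sub>F N in sequentially. F_hat X N \<omega> B > 0"
      by (rule order_tendstoD(1)[OF elim(2) B_pos])
    then have "\<forall>\<^sub>F N in sequentially.
        mu_hat X (\<lambda>n \<omega>. h (X n \<omega>)) N \<omega> B / F_hat X N \<omega> B = cell_ratio X (\<lambda>n \<omega>. h (X n \<omega>)) N \<omega> B"
      by eventually_elim (simp add: cell_ratio_def)
    ultimately show ?case
      by (rule Lim_transform_eventually)
  qed
qed

text \<open>
  Evaluation at the cell of a random point is a finite sum, which yields measurability.
\<close>
lemma at_cell_eq_sum:
  fixes F :: "(real ^ 2) set \<Rightarrow> real"
  assumes "x \<in> unit_square"
  shows "F (cell (dyadic_grid a b) x) = (\<Sum>B\<in>dyadic_grid a b. indicator B x * F B)"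
proof -
  have "(\<Sum>B\<in>dyadic_grid a b. indicator B x * F B) =
      (\<Sum>B\<in>{cell (dyadic_grid a b) x}. indicator B x * F B)"
  proof (rule sum.mono_neutral_right)
    show "\<forall>B\<in>dyadic_grid a b - {cell (dyadic_grid a b) x}. indicator B x * F B = 0"
      using cell_dyadic_grid_eq by (auto simp: indicator_def)
  qed (use assms cell_in_dyadic_grid in auto)
  then show ?thesis
    using mem_cell_dyadic_grid[OF assms] by simp
qed

lemma at_cell_measurable:
  fixes F :: "'w \<Rightarrow> (real ^ 2) set \<Rightarrow> real"
  assumes [measurable]: "X \<in> borel_measurable M" and X: "\<And>\<omega>. \<omega> \<in> space M \<Longrightarrow> X \<omega> \<in> unit_square"
    and F: "\<And>B. B \<in> dyadic_grid a b \<Longrightarrow> (\<lambda>\<omega>. F \<omega> B) \<in> borel_measurable M"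
  shows "(\<lambda>\<omega>. F \<omega> (cell (dyadic_grid a b) (X \<omega>))) \<in> borel_measurable M"
proof -
  have "(\<lambda>\<omega>. \<Sum>B\<in>dyadic_grid a b. indicator B (X \<omega>) * F \<omega> B) \<in> borel_measurable M"
  proof (rule borel_measurable_sum)
    fix B assume B: "B \<in> dyadic_grid a b"
    note [measurable] = F[OF B] dyadic_grid_borel[OF B]
    show "(\<lambda>\<omega>. indicator B (X \<omega>) * F \<omega> B) \<in> borel_measurable M" by measurable
  qed
  also have "?this \<longleftrightarrow> ?thesis"
    by (rule measurable_cong) (simp add: at_cell_eq_sum[OF X])
  finally show ?thesis .
qed

text \<open>
  The coordinates of an infinite product space. The second components of the coordinates are almost
  surely constant: all randomness of the pairs lies in the points, which determine the responses.
\<close>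
lemma uniform_sample_exists:
  fixes h :: "real ^ 2 \<Rightarrow> real"
  assumes [measurable]: "h \<in> borel_measurable borel"
  obtains M :: "(nat \<Rightarrow> (real ^ 2) \<times> real) measure" and X :: "nat \<Rightarrow> (nat \<Rightarrow> (real ^ 2) \<times> real) \<Rightarrow> real ^ 2"
  where "prob_space M" "iid_pairs M X (\<lambda>n \<omega>. h (X n \<omega>))" "\<And>n. uniform_on_unit_square M (X n)"
proof -
  define U where "U = uniform_measure lborel unit_square"
  have U: "prob_space U" unfolding U_def by (rule prob_space_uniform_measure) auto
  have sets_U [measurable_cong]: "sets U = sets borel" by (simp add: U_def)
  define D where "D = distr U borel (\<lambda>x. (x, 0 :: real))"
  have sets_D [measurable_cong]: "sets D = sets borel" by (simp add: D_def)
  have pair [measurable]: "(\<lambda>x :: real ^ 2. (x, 0 :: real)) \<in> borel_measurable borel"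
    by (intro borel_measurable_continuous_onI continuous_intros)
  have D: "prob_space D"
    unfolding D_def by (rule prob_space.prob_space_distr[OF U]) measurable
  define M where "M = PiM (UNIV :: nat set) (\<lambda>_. D)"
  interpret M: prob_space M
    unfolding M_def by (rule prob_space_PiM) (rule D)
  define c :: "real ^ 2" where "c = (\<chi> i. 1 / 2)"
  have c: "c \<in> unit_square" by (simp add: c_def unit_square_def)
  \<comment> \<open>The points have to lie in the square for every outcome, so values outside are replaced.\<close>
  define proj where "proj x = (if x \<in> unit_square then x else c)" for x
  have proj [measurable]: "proj \<in> borel_measurable borel"
    unfolding proj_def by measurable
  have fst [measurable]: "(fst :: (real ^ 2) \<times> real \<Rightarrow> _) \<in> borel_measurable borel"
    by (intro borel_measurable_continuous_onI continuous_intros)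
  have proj_fst: "(\<lambda>z. proj (fst z)) \<in> borel_measurable (borel :: ((real ^ 2) \<times> real) measure)"
    by (rule measurable_compose[OF fst proj])
  then have proj_fst_D: "(\<lambda>z. proj (fst z)) \<in> borel_measurable D"
    unfolding measurable_cong_sets[OF sets_D refl] .
  define X where "X n \<omega> = proj (fst (\<omega> n))" for n :: nat and \<omega> :: "nat \<Rightarrow> (real ^ 2) \<times> real"
  have coord [measurable]: "(\<lambda>\<omega>. \<omega> n) \<in> measurable M D" for n
    unfolding M_def by (rule measurable_component_singleton) simp
  have coord_distr: "distr M D (\<lambda>\<omega>. \<omega> n) = D" for n
    unfolding M_def by (rule distr_PiM_component) (auto intro: D)
  have indep: "M.indep_vars (\<lambda>_. D) (\<lambda>n \<omega>. \<omega> n) UNIV"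
  proof (subst M.indep_vars_iff_distr_eq_PiM)
    have "distr M (PiM UNIV (\<lambda>_. D)) (\<lambda>\<omega>. \<lambda>n\<in>UNIV. \<omega> n) = M"
      unfolding M_def restrict_UNIV by (rule distr_id)
    also have "M = PiM UNIV (\<lambda>n. distr M D (\<lambda>\<omega>. \<omega> n))"
      unfolding coord_distr by (simp add: M_def)
    finally show "distr M (PiM UNIV (\<lambda>_. D)) (\<lambda>\<omega>. \<lambda>n\<in>UNIV. \<omega> n) = PiM UNIV (\<lambda>n. distr M D (\<lambda>\<omega>. \<omega> n))" .
  qed auto
  define \<psi> where "\<psi> z = (proj (fst z), h (proj (fst z)))" for z :: "(real ^ 2) \<times> real"
  have \<psi> [measurable]: "\<psi> \<in> borel_measurable D"
    unfolding \<psi>_def borel_prod[symmetric] by measurable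
  have XY: "(\<lambda>\<omega>. (X n \<omega>, h (X n \<omega>))) = (\<lambda>\<omega>. \<psi> (\<omega> n))" for n
    by (simp add: X_def \<psi>_def)
  have "iid_pairs M X (\<lambda>n \<omega>. h (X n \<omega>))"
    unfolding iid_pairs_def XY
  proof (intro conjI allI)
    show "M.indep_vars (\<lambda>_. borel) (\<lambda>n \<omega>. \<psi> (\<omega> n)) UNIV"
      by (rule M.indep_vars_compose2[OF indep]) simp
    have "distr M borel (\<lambda>\<omega>. \<psi> (\<omega> n)) = distr D borel \<psi>" for n
      using distr_distr[of \<psi> D borel "\<lambda>\<omega>. \<omega> n" M] by (simp add: coord_distr comp_def)
    then show "distr M borel (\<lambda>\<omega>. \<psi> (\<omega> n)) = distr M borel (\<lambda>\<omega>. \<psi> (\<omega> 0))" for n by simp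
  qed
  moreover have "uniform_on_unit_square M (X n)" for n
    unfolding uniform_on_unit_square_def
  proof (intro conjI ballI)
    show "X n \<in> borel_measurable M"
      unfolding X_def by (rule measurable_compose[OF coord proj_fst_D])
    show "X n \<omega> \<in> unit_square" for \<omega> using c by (simp add: X_def proj_def)
    have "distr M lborel (X n) = distr (distr M D (\<lambda>\<omega>. \<omega> n)) lborel (\<lambda>z. proj (fst z))"
      using distr_distr[of "\<lambda>z. proj (fst z)" D lborel "\<lambda>\<omega>. \<omega> n" M] proj_fst_D
      by (simp add: X_def[abs_def] comp_def)
    also have "\<dots> = distr U lborel proj"
      unfolding coord_distr unfolding D_def
      by (subst distr_distr) (use proj_fst in \<open>auto simp: comp_def\<close>)
    also have "\<dots> = distr U lborel (\<lambda>x. x)"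
    proof (rule distr_cong_AE)
      show "AE x in U. proj x = x"
        unfolding U_def by (subst AE_uniform_measure) (auto simp: proj_def)
    qed auto
    also have "\<dots> = U"
      by (rule distr_id2) (simp add: U_def)
    finally show "distr M lborel (X n) = uniform_measure lborel unit_square"
      by (simp add: U_def)
  qed
  ultimately show thesis
    using that[of M X] M.prob_space_axioms by blast
qed

lemma regression_function_of_design:
  assumes M: "prob_space M" and X [measurable]: "X \<in> borel_measurable M"
    and h [measurable]: "h \<in> borel_measurable borel" and int: "integrable M (\<lambda>\<omega>. h (X \<omega>))"
  shows "regression_function M X (\<lambda>\<omega>. h (X \<omega>)) h"
proof -
  interpret prob_space M by fact
  define F where "F = vimage_algebra (space M) X borel"
  have "subalgebra M F"
    unfolding subalgebra_def F_def
    by (auto simp: sets_vimage_algebra2 intro: measurable_sets[OF X])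
  then interpret finite_measure_subalgebra M F
    by unfold_locales
  have "X \<in> measurable F borel"
    unfolding F_def by (rule measurable_vimage_algebra1) simp
  then have "(\<lambda>\<omega>. h (X \<omega>)) \<in> borel_measurable F"
    by measurable
  then have "AE \<omega> in M. real_cond_exp M F (\<lambda>\<omega>. h (X \<omega>)) \<omega> = h (X \<omega>)"
    by (intro real_cond_exp_F_meas int)
  then show ?thesis
    unfolding regression_function_def F_def[symmetric]
    by (auto intro: measurable_restrict_space1)
qed

lemma cell_average_eq_box_average: "cell_average Q h x = box_average h (cell Q x)"
  by (simp add: cell_average_def box_average_def)

lemma empirical_estimate_eq_cell_ratio:
  "empirical_estimate Q X Y N \<omega> x = cell_ratio X Y N \<omega> (cell (Q N) x)"
  by (simp add: empirical_estimate_def cell_ratio_def Let_def)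

section \<open>Nonnegative functions are of first category\<close>

text \<open>
  Near any integrable function \<open>f\<close> there is a function \<open>f'\<close> that equals \<open>-1\<close> on a thin strip. Every
  nonnegative function differs from \<open>f'\<close> by at least \<open>1\<close> on the strip, hence has a distance from \<open>f'\<close>
  of at least the area of the strip. So no ball lies in the closure of a set of nonnegative functions.
\<close>
lemma nowhere_dense_nonneg_classes:
  assumes S: "S \<subseteq> {L1_class h | h. integrable square_measure h \<and> (\<forall>x\<in>unit_square. 0 \<le> h x)}"
  shows "nowhere_dense_in L1_topology S"
proof -
  interpret L: Metric_space L1_space L1_dist by (rule Metric_space_L1)
  have [simp]: "space square_measure = unit_square"
    by (simp add: space_restrict_space)
  define B where "B n = dyadic_box n 0 0 0" for n
  have B_sub: "B n \<subseteq> unit_square" for n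
    by (auto simp: B_def dyadic_box_def)
  have B_sets [measurable]: "B n \<in> sets square_measure" for n
    unfolding sets_restrict_space B_def
    using B_sub[of n] by (auto simp: B_def intro!: image_eqI[of _ _ "dyadic_box n 0 0 0"] dyadic_box_borel)
  have B_int: "(LINT x|square_measure. indicat_real (B n) x) = 1 / 2 ^ n"
    and B_integrable: "integrable square_measure (indicat_real (B n))" for n
  proof -
    have "emeasure square_measure (B n) = emeasure lborel (B n)"
      using B_sub by (intro emeasure_restrict_space) auto
    also have "\<dots> = ennreal (1 / 2 ^ n)"
      unfolding B_def by (subst emeasure_dyadic_box) auto
    finally have em: "emeasure square_measure (B n) = ennreal (1 / 2 ^ n)" .
    then have "measure square_measure (B n) = 1 / 2 ^ n"
      by (simp add: measure_def)
    then show "(LINT x|square_measure. indicat_real (B n) x) = 1 / 2 ^ n"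
      using B_sub[of n] by (simp add: Int_absorb2)
    show "integrable square_measure (indicat_real (B n))"
      using em by (intro integrable_real_indicator B_sets) simp
  qed
  have "L1_topology interior_of (L1_topology closure_of S) = {}"
  proof (rule ccontr)
    assume "L1_topology interior_of (L1_topology closure_of S) \<noteq> {}"
    then obtain c T where T: "openin L1_topology T" "c \<in> T" "T \<subseteq> L1_topology closure_of S"
      by (auto simp: interior_of_def)
    then obtain r where r: "r > 0" "L.mball c r \<subseteq> L1_topology closure_of S" and c: "c \<in> L1_space"
      unfolding L1_topology_def L.openin_mtopology by blast
    obtain f where f [simp]: "integrable square_measure f" and cf: "c = L1_class f"
      using c by (rule L1_space_cases)
    have [measurable]: "f \<in> borel_measurable square_measure"
      using f by (rule borel_measurable_integrable)
    have one [simp]: "integrable square_measure (\<lambda>_. 1 :: real)"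
      by (simp add: integrable_restrict_space set_integrable_def)
    have "(\<lambda>n. LINT x|square_measure. indicator (B n) x * (\<bar>f x\<bar> + 1)) \<longlonglongrightarrow> (LINT x|square_measure. 0)"
    proof (rule integral_dominated_convergence[where w = "\<lambda>x. \<bar>f x\<bar> + 1"])
      show "AE x in square_measure. (\<lambda>n. indicator (B n) x * (\<bar>f x\<bar> + 1)) \<longlonglongrightarrow> 0"
      proof (rule AE_I2)
        fix x assume "x \<in> space square_measure"
        then have x: "0 < x $ 1" by (simp add: mem_unit_square)
        obtain N where N: "(1 / 2) ^ N < x $ 1"
          using real_arch_pow_inv[OF x, of "1/2"] by auto
        have "indicat_real (B n) x = 0" if "n \<ge> N" for n
        proof -
          have "1 / 2 ^ n \<le> (1 / 2 :: real) ^ N"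
            using power_decreasing[OF that, of "1/2 :: real"] by (simp add: power_one_over)
          then show ?thesis using N by (auto simp: B_def dyadic_box_def)
        qed
        then have "\<forall>\<^sub>F n in sequentially. indicator (B n) x * (\<bar>f x\<bar> + 1) = 0"
          unfolding eventually_sequentially by (intro exI[of _ N]) simp
        then show "(\<lambda>n. indicator (B n) x * (\<bar>f x\<bar> + 1)) \<longlonglongrightarrow> 0"
          by (rule tendsto_eventually)
      qed
      show "AE x in square_measure. norm (indicator (B n) x * (\<bar>f x\<bar> + 1)) \<le> \<bar>f x\<bar> + 1" for n
        by (auto simp: indicator_def)
    qed auto
    then have "\<forall>\<^sub>F n in sequentially. (LINT x|square_measure. indicator (B n) x * (\<bar>f x\<bar> + 1)) < r"
      by (rule order_tendstoD(2)) (use r in simp)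
    then obtain n where n: "(LINT x|square_measure. indicator (B n) x * (\<bar>f x\<bar> + 1)) < r"
      by (auto simp: eventually_sequentially)
    define f' where "f' x = (if x \<in> B n then -1 else f x)" for x
    have meas_f' [measurable]: "f' \<in> borel_measurable square_measure"
      unfolding f'_def by measurable
    have f' [simp]: "integrable square_measure f'"
      by (rule Bochner_Integration.integrable_bound[of _ "\<lambda>x. \<bar>f x\<bar> + 1"]) (auto simp: f'_def)
    have dom: "integrable square_measure (\<lambda>x. indicator (B n) x * (\<bar>f x\<bar> + 1))"
      by (rule Bochner_Integration.integrable_bound[of _ "\<lambda>x. \<bar>f x\<bar> + 1"]) (auto simp: indicator_def)
    have "L1_dist c (L1_class f') = (LINT x|square_measure. \<bar>f x - f' x\<bar>)"
      by (simp add: cf L1_dist_class)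
    also have "\<dots> \<le> (LINT x|square_measure. indicator (B n) x * (\<bar>f x\<bar> + 1))"
      by (intro integral_mono integrable_abs Bochner_Integration.integrable_diff f f' dom)
        (auto simp: f'_def)
    finally have "L1_class f' \<in> L.mball c r"
      using n c by (simp add: L1_class_in_L1_space)
    then have "L1_class f' \<in> L.mtopology closure_of S"
      using r(2) by (auto simp: L1_topology_def)
    moreover have "(1 / 2 ^ n :: real) > 0" by simp
    ultimately obtain y where y: "y \<in> S" "y \<in> L.mball (L1_class f') (1 / 2 ^ n)"
      unfolding L.metric_closure_of by blast
    obtain h where h [simp]: "integrable square_measure h" and yh: "y = L1_class h"
      and h0: "\<forall>x\<in>unit_square. 0 \<le> h x"
      using y(1) S by blast
    have "1 / 2 ^ n = (LINT x|square_measure. indicat_real (B n) x)"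
      by (rule B_int[symmetric])
    also have "\<dots> \<le> (LINT x|square_measure. \<bar>f' x - h x\<bar>)"
      by (intro integral_mono B_integrable integrable_abs Bochner_Integration.integrable_diff f' h)
        (use h0 in \<open>auto simp: f'_def indicator_def\<close>)
    also have "\<dots> = L1_dist (L1_class f') y"
      by (simp add: yh L1_dist_class)
    also have "\<dots> < 1 / 2 ^ n"
      using y(2) by simp
    finally show False by simp
  qed
  moreover have "S \<subseteq> topspace L1_topology"
    using S by (auto simp: L1_topology_def L1_class_in_L1_space)
  ultimately show ?thesis by (simp add: nowhere_dense_in_def)
qed

text \<open>
  As \<open>X\<close> is uniform, integrability of \<open>f (X \<omega>)\<close> says that \<open>f\<close> belongs to \<open>L\<^sup>1\<close>. The set is thus itself a
  nowhere dense part of the cone of nonnegative functions.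
\<close>
lemma first_category_nonneg_classes:
  assumes unif: "uniform_on_unit_square M X"
  shows "first_category_in L1_topology
    {L1_class f | f. f \<in> borel_measurable square_measure \<and> (\<forall>x\<in>unit_square. f x \<ge> 0) \<and>
       integrable M (\<lambda>\<omega>. f (X \<omega>)) \<and> P f}" (is "first_category_in _ ?S")
proof -
  have "integrable square_measure f"
    if f: "f \<in> borel_measurable square_measure" and int: "integrable M (\<lambda>\<omega>. f (X \<omega>))" for f :: "real ^ 2 \<Rightarrow> real"
  proof -
    define g where "g x = indicator unit_square x *\<^sub>R f x" for x
    have idem: "indicator unit_square x * (indicator unit_square x * f x) = indicator unit_square x * f x" for x
      by (simp add: indicator_def)
    have [measurable]: "g \<in> borel_measurable borel"
      using f unfolding g_def by (subst (asm) borel_measurable_restrict_space_iff) auto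
    have "integrable M (\<lambda>\<omega>. g (X \<omega>))"
      using int unif
      by (subst Bochner_Integration.integrable_cong[OF refl, of _ _ "\<lambda>\<omega>. f (X \<omega>)"])
        (auto simp: g_def uniform_on_unit_square_def)
    then have "set_integrable lborel unit_square g"
      using integrable_uniform[OF unif, of g] by simp
    then have "set_integrable lborel unit_square f"
      by (simp add: set_integrable_def g_def idem)
    then show ?thesis
      by (simp add: integrable_restrict_space set_integrable_def)
  qed
  then have "nowhere_dense_in L1_topology ?S"
    by (intro nowhere_dense_nonneg_classes) blast
  then show ?thesis
    unfolding first_category_in_def by (intro exI[of _ "{?S}"]) auto
qed

section \<open>A consistent estimate of a divergent target\<close>

theorem theorem1p3:
  shows "\<exists>(Q :: nat \<Rightarrow> (real ^ 2) set set)
           (M :: (nat \<Rightarrow> (real ^ 2) \<times> real) measure)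
           (X :: nat \<Rightarrow> (nat \<Rightarrow> (real ^ 2) \<times> real) \<Rightarrow> real ^ 2)
           (Y :: nat \<Rightarrow> (nat \<Rightarrow> (real ^ 2) \<times> real) \<Rightarrow> real)
           (m :: real ^ 2 \<Rightarrow> real).
      (\<forall>N\<ge>1. tree_structured_partition (Q N) \<and> (\<forall>B\<in>Q N. emeasure lborel B > 0)) \<and>
      (\<lambda>N. partition_norm (Q N)) \<longlonglongrightarrow> 0 \<and>
      prob_space M \<and>
      iid_pairs M X Y \<and>
      (\<forall>n. uniform_on_unit_square M (X n)) \<and>
      (\<forall>n. \<forall>\<omega>\<in>space M. Y n \<omega> \<ge> 0) \<and>
      integrable M (Y 0) \<and>
      regression_function M (X 0) (Y 0) m \<and>
      has_probability M (\<lambda>\<omega>. (\<lambda>N. empirical_estimate Q X Y N \<omega> (X 0 \<omega>)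
                                  - cell_average (Q N) m (X 0 \<omega>)) \<longlonglongrightarrow> 0) 1 \<and>
      has_probability M (\<lambda>\<omega>. (\<lambda>N. cell_average (Q N) m (X 0 \<omega>) - m (X 0 \<omega>)) \<longlonglongrightarrow> 0) 0 \<and>
      has_probability M (\<lambda>\<omega>. (\<lambda>N. empirical_estimate Q X Y N \<omega> (X 0 \<omega>)) \<longlonglongrightarrow> m (X 0 \<omega>)) 0 \<and>
      first_category_in L1_topology
        {L1_class h | h. h \<in> borel_measurable square_measure \<and>
           (\<forall>x\<in>unit_square. h x \<ge> 0) \<and>
           integrable M (\<lambda>\<omega>. h (X 0 \<omega>)) \<and>
           (\<exists>x\<in>unit_square. limsup (\<lambda>N. ereal (cell_average (Q N) h x)) < \<infinity>)}"
proof -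
  obtain h A where h [measurable]: "h \<in> borel_measurable borel" "\<And>x. 0 \<le> h x" "integrable lborel h"
    and osc: "AE x in lborel. x \<in> unit_square \<longrightarrow>
       (\<forall>c. \<exists>k. \<exists>a\<in>{k..A k}. \<exists>b\<in>{k..A k}. c \<le> cell_average (dyadic_grid a b) h x)"
    using oscillating_function_exists by blast
  obtain \<alpha> \<beta> where \<alpha>: "filterlim \<alpha> at_top sequentially" and \<beta>: "filterlim \<beta> at_top sequentially"
    and all_levels: "\<And>k a b. a \<in> {k..A k} \<Longrightarrow> b \<in> {k..A k} \<Longrightarrow> \<exists>j. \<alpha> j = a \<and> \<beta> j = b"
    using level_enumeration_exists[of A] by blast
  \<comment> \<open>The grids in the order in which they will be used, each for a long time.\<close>
  define P where "P j = dyadic_grid (\<alpha> j) (\<beta> j)" for j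
  obtain M :: "(nat \<Rightarrow> (real ^ 2) \<times> real) measure" and X
    where M: "prob_space M" and iid: "iid_pairs M X (\<lambda>n \<omega>. h (X n \<omega>))"
    and unif: "\<And>n. uniform_on_unit_square M (X n)"
    using uniform_sample_exists[OF h(1)] by blast
  interpret prob_space M by fact
  have X [measurable]: "X n \<in> borel_measurable M"
    and X_square: "\<omega> \<in> space M \<Longrightarrow> X n \<omega> \<in> unit_square" for n \<omega>
    using unif[of n] by (auto simp: uniform_on_unit_square_def)
  define Y where "Y n \<omega> = h (X n \<omega>)" for n \<omega>
  have Y_eq: "Y = (\<lambda>n \<omega>. h (X n \<omega>))" by (simp add: Y_def[abs_def])
  have Y [measurable]: "Y n \<in> borel_measurable M" for n
    unfolding Y_eq by measurable
  \<comment> \<open>Summing over the cells bounds the error uniformly in the point of evaluation.\<close>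
  define e where "e j N \<omega> = (\<Sum>B\<in>P j. \<bar>cell_ratio X Y N \<omega> B - box_average h B\<bar>)" for j N \<omega>
  have e_meas: "e j N \<in> borel_measurable M" for j N
    unfolding e_def P_def
    by (intro borel_measurable_sum borel_measurable_abs borel_measurable_diff cell_ratio_measurable X Y)
      (auto intro: dyadic_grid_borel)
  have e_lim: "AE \<omega> in M. (\<lambda>N. e j N \<omega>) \<longlonglongrightarrow> 0" for j
  proof -
    have "AE \<omega> in M. (\<lambda>N. cell_ratio X Y N \<omega> B) \<longlonglongrightarrow> box_average h B" if B: "B \<in> P j" for B
      unfolding Y_eq
    proof (rule cell_ratio_tendsto[OF M iid unif h])
      show "B \<in> sets borel" using B unfolding P_def by (rule dyadic_grid_borel)
      show "B \<subseteq> unit_square" using B by (auto simp: P_def dyadic_grid_def dyadic_box_def)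
      show "emeasure lborel B > 0" using B by (simp add: P_def emeasure_dyadic_grid)
    qed
    then have "AE \<omega> in M. \<forall>B\<in>P j. (\<lambda>N. cell_ratio X Y N \<omega> B) \<longlonglongrightarrow> box_average h B"
      by (intro AE_finite_allI) (auto simp: P_def)
    then show ?thesis
    proof eventually_elim
      case (elim \<omega>)
      show ?case
        unfolding e_def
        by (intro tendsto_null_sum tendsto_rabs_zero LIM_zero) (use elim in blast)
    qed
  qed
  obtain s \<kappa> :: "nat \<Rightarrow> nat" where s: "strict_mono s" and \<kappa>_s: "\<And>j. \<kappa> (s j) = j"
    and \<kappa>: "filterlim \<kappa> at_top sequentially" and slow: "AE \<omega> in M. (\<lambda>N. e (\<kappa> N) N \<omega>) \<longlonglongrightarrow> 0"
    using slow_schedule_exists[of e, OF e_meas e_lim] by blast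
  define Q where "Q N = P (\<kappa> N)" for N

  have tree: "\<forall>N\<ge>1. tree_structured_partition (Q N) \<and> (\<forall>B\<in>Q N. emeasure lborel B > 0)"
    by (simp add: Q_def P_def tree_structured_dyadic_grid emeasure_dyadic_grid)
  have norm: "(\<lambda>N. partition_norm (Q N)) \<longlonglongrightarrow> 0"
  proof (rule tendsto_sandwich[of "\<lambda>_. 0"])
    have half: "(\<lambda>n. 1 / 2 ^ n :: real) \<longlonglongrightarrow> 0"
      using LIMSEQ_realpow_zero[of "1/2 :: real"] by (simp add: power_one_over)
    show "(\<lambda>N. 1 / 2 ^ \<alpha> (\<kappa> N) + 1 / 2 ^ \<beta> (\<kappa> N) :: real) \<longlonglongrightarrow> 0"
      using filterlim_compose[OF half filterlim_compose[OF \<alpha> \<kappa>]]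
        filterlim_compose[OF half filterlim_compose[OF \<beta> \<kappa>]]
      by (intro tendsto_add_zero)
    show "\<forall>\<^sub>F N in sequentially. 0 \<le> partition_norm (Q N)"
      by (simp add: Q_def P_def partition_norm_dyadic_grid)
    show "\<forall>\<^sub>F N in sequentially. partition_norm (Q N) \<le> 1 / 2 ^ \<alpha> (\<kappa> N) + 1 / 2 ^ \<beta> (\<kappa> N)"
      by (simp add: Q_def P_def partition_norm_dyadic_grid)
  qed simp
  have intY: "integrable M (\<lambda>\<omega>. h (X 0 \<omega>))"
    unfolding integrable_uniform[OF unif h(1)] set_integrable_def
    by (intro integrable_mult_indicator h) simp
  have reg: "regression_function M (X 0) (Y 0) h"
    unfolding Y_eq by (rule regression_function_of_design[OF M X h(1) intY])

  have est_meas [measurable]: "(\<lambda>\<omega>. empirical_estimate Q X Y N \<omega> (X 0 \<omega>)) \<in> borel_measurable M" for N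
    unfolding empirical_estimate_eq_cell_ratio Q_def P_def
    by (rule at_cell_measurable[OF X]) (auto intro!: X_square cell_ratio_measurable X Y dyadic_grid_borel)
  have avg_meas [measurable]: "(\<lambda>\<omega>. cell_average (Q N) h (X 0 \<omega>)) \<in> borel_measurable M" for N
    unfolding cell_average_eq_box_average Q_def P_def
    by (rule at_cell_measurable[OF X]) (auto intro!: X_square)

  have conv: "AE \<omega> in M. (\<lambda>N. empirical_estimate Q X Y N \<omega> (X 0 \<omega>) - cell_average (Q N) h (X 0 \<omega>)) \<longlonglongrightarrow> 0"
    using slow AE_space
  proof eventually_elim
    case (elim \<omega>)
    have "\<bar>empirical_estimate Q X Y N \<omega> (X 0 \<omega>) - cell_average (Q N) h (X 0 \<omega>)\<bar> \<le> e (\<kappa> N) N \<omega>" for N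
    proof -
      have "cell (Q N) (X 0 \<omega>) \<in> P (\<kappa> N)"
        unfolding Q_def P_def by (intro cell_in_dyadic_grid X_square elim)
      then show ?thesis
        unfolding empirical_estimate_eq_cell_ratio cell_average_eq_box_average e_def
        by (intro member_le_sum[of _ _ "\<lambda>B. \<bar>cell_ratio X Y N \<omega> B - box_average h B\<bar>"])
          (auto simp: P_def)
    qed
    then show ?case
      by (intro Lim_null_comparison[OF _ elim(1)]) simp
  qed
  have div: "AE \<omega> in M. \<not> (\<lambda>N. cell_average (Q N) h (X 0 \<omega>) - h (X 0 \<omega>)) \<longlonglongrightarrow> 0"
  proof (rule AE_uniform[OF unif])
    show "AE x in lborel. x \<in> unit_square \<longrightarrow> \<not> (\<lambda>N. cell_average (Q N) h x - h x) \<longlonglongrightarrow> 0"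
      using osc
    proof eventually_elim
      case (elim x)
      show ?case
      proof (intro impI notI)
        assume x: "x \<in> unit_square" and "(\<lambda>N. cell_average (Q N) h x - h x) \<longlonglongrightarrow> 0"
        then have "(\<lambda>N. cell_average (Q N) h x) \<longlonglongrightarrow> h x"
          by (simp add: LIM_zero_iff)
        \<comment> \<open>Along \<open>s\<close> every grid of the list is met, so convergence would bound all of their averages.\<close>
        then have "((\<lambda>N. cell_average (Q N) h x) \<circ> s) \<longlonglongrightarrow> h x"
          using s by (rule LIMSEQ_subseq_LIMSEQ)
        then have "(\<lambda>j. cell_average (P j) h x) \<longlonglongrightarrow> h x"
          by (simp add: comp_def Q_def \<kappa>_s)
        then have "Bseq (\<lambda>j. cell_average (P j) h x)"
          by (intro convergent_imp_Bseq convergentI)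
        then obtain c where c: "\<forall>j. norm (cell_average (P j) h x) \<le> c"
          by (rule BseqE)
        obtain k a b where "a \<in> {k..A k}" "b \<in> {k..A k}" "c + 1 \<le> cell_average (dyadic_grid a b) h x"
          using elim[THEN mp, OF x, THEN spec, of "c + 1"] by blast
        moreover from this obtain j where "\<alpha> j = a" "\<beta> j = b"
          using all_levels by blast
        ultimately show False
          using c[THEN spec, of j] by (simp add: P_def)
      qed
    qed
  qed
  have div_est: "AE \<omega> in M. \<not> (\<lambda>N. empirical_estimate Q X Y N \<omega> (X 0 \<omega>)) \<longlonglongrightarrow> h (X 0 \<omega>)"
    using conv div
  proof eventually_elim
    case (elim \<omega>)
    show ?case
    proof
      assume "(\<lambda>N. empirical_estimate Q X Y N \<omega> (X 0 \<omega>)) \<longlonglongrightarrow> h (X 0 \<omega>)"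
      from tendsto_diff[OF this elim(1)]
      have "(\<lambda>N. cell_average (Q N) h (X 0 \<omega>)) \<longlonglongrightarrow> h (X 0 \<omega>)" by simp
      then show False using elim(2) by (simp add: LIM_zero_iff)
    qed
  qed

  have hX [measurable]: "(\<lambda>\<omega>. h (X 0 \<omega>)) \<in> borel_measurable M" by measurable
  have p1: "has_probability M (\<lambda>\<omega>. (\<lambda>N. empirical_estimate Q X Y N \<omega> (X 0 \<omega>)
      - cell_average (Q N) h (X 0 \<omega>)) \<longlonglongrightarrow> 0) 1"
  proof -
    have ev: "{\<omega> \<in> space M. (\<lambda>N. empirical_estimate Q X Y N \<omega> (X 0 \<omega>)
        - cell_average (Q N) h (X 0 \<omega>)) \<longlonglongrightarrow> 0} \<in> sets M" by measurable
    show ?thesis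
      unfolding has_probability_def using prob_Collect_eq_1[OF ev] conv ev by blast
  qed
  have p2: "has_probability M (\<lambda>\<omega>. (\<lambda>N. cell_average (Q N) h (X 0 \<omega>) - h (X 0 \<omega>)) \<longlonglongrightarrow> 0) 0"
  proof -
    have ev: "{\<omega> \<in> space M. (\<lambda>N. cell_average (Q N) h (X 0 \<omega>) - h (X 0 \<omega>)) \<longlonglongrightarrow> 0} \<in> sets M"
      by measurable
    show ?thesis
      unfolding has_probability_def using prob_Collect_eq_0[OF ev] div ev by blast
  qed
  have p3: "has_probability M (\<lambda>\<omega>. (\<lambda>N. empirical_estimate Q X Y N \<omega> (X 0 \<omega>)) \<longlonglongrightarrow> h (X 0 \<omega>)) 0"
  proof -
    have ev: "{\<omega> \<in> space M. (\<lambda>N. empirical_estimate Q X Y N \<omega> (X 0 \<omega>)) \<longlonglongrightarrow> h (X 0 \<omega>)} \<in> sets M"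
      by measurable
    show ?thesis
      unfolding has_probability_def using prob_Collect_eq_0[OF ev] div_est ev by blast
  qed

  show ?thesis
  proof (intro exI[of _ Q] exI[of _ M] exI[of _ X] exI[of _ Y] exI[of _ h] conjI)
    show "iid_pairs M X Y" unfolding Y_eq by (rule iid)
    show "\<forall>n. uniform_on_unit_square M (X n)" using unif by blast
    show "\<forall>n. \<forall>\<omega>\<in>space M. 0 \<le> Y n \<omega>" by (simp add: Y_def h(2))
    show "integrable M (Y 0)" using intY by (simp add: Y_def[abs_def])
    show "first_category_in L1_topology
        {L1_class h | h. h \<in> borel_measurable square_measure \<and>
           (\<forall>x\<in>unit_square. h x \<ge> 0) \<and>
           integrable M (\<lambda>\<omega>. h (X 0 \<omega>)) \<and>
           (\<exists>x\<in>unit_square. limsup (\<lambda>N. ereal (cell_average (Q N) h x)) < \<infinity>)}"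
      by (rule first_category_nonneg_classes[OF unif])
  qed (fact tree norm M reg p1 p2 p3)+
qed

end
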